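(* Let $T$ be a complete first-order theory with monster model $\mathfrak{C}$. Let $p=\mathrm{tp}(a/A)$ be an NIP (respectively stable) type which is definable over some model $M\subseteq A$. Then $p\restriction M$ is NIP (respectively stable) and $\mathrm{dpr}(p\restriction M)=\mathrm{dpr}(p)$.
   Context: $T$ is a complete first-order theory in a language $\mathcal{L}$ and $\mathfrak{C}$ is its monster model; all parameter sets and models are contained in $\mathfrak{C}$. Tuples may be infinite. For a property $t$, $\varphi^{(t)}$ is $\varphi$ if $t$ holds and $\neg\varphi$ otherwise. A partial type $\pi(x)$ has IP if there are a formula $\varphi(x,y)\in\mathcal{L}$ and a sequence $(a_i)_{i<\omega}$ of realizations of $\pi$ such that for every $s\subseteq\omega$ the set $\{\varphi(a_i,y)^{(i\in s)} : i<\omega\}$ is consistent; $\pi$ is NIP if it does not have IP. A partial type $\pi(x)$ over $A$ is stable if every extension $q\in S(C)$ of $\pi$, over every $C\supseteq A$, is definable. dp-rank: for a partial type $\Sigma(x)$ over $A$ and a cardinal $\kappa$, $\mathrm{dpr}(\Sigma)<\kappa$ if for every family $(I_\alpha)_{\alpha<\kappa}$ of $A$-mutually indiscernible infinite sequences and every $b\models\Sigma$ there is $\beta<\kappa$ such that $I_\beta$ is indiscernible over $bA$; otherwise $\mathrm{dpr}(\Sigma)\ge\kappa$. (This does not depend on the set $A$ containing the parameters of $\Sigma$.) $\mathrm{dpr}(\Sigma)=\mathrm{dpr}(\Sigma')$ means that for every cardinal $\kappa$, $\mathrm{dpr}(\Sigma)<\kappa$ iff $\mathrm{dpr}(\Sigma')<\kappa$.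 *)

theory Defs
  imports Main
begin

unbundle cardinal_syntax

section \<open>First-order syntax and semantics\<close>

text \<open>
  Quantified variables are de Bruijn indices (\<open>Bnd\<close>), free variables are names of an arbitrary
  type \<open>'v\<close>; hence \<open>map_fm\<close> renames free variables, or plugs in parameters for them, without
  capture.
  A symbol together with an arity belongs to the language; the symbol types themselves carry no
  information, so that for instance a language without function symbols has \<open>Funs L = {}\<close>.
\<close>

datatype (dead 'f, tfv: 'v) trm = Var 'v | Bnd nat | App 'f "('f, 'v) trm list"

datatype (dead 'f, dead 'r, fv: 'v) fm =
    Eq "('f, 'v) trm" "('f, 'v) trm"
  | Rel 'r "('f, 'v) trm list"
  | Neg "('f, 'r, 'v) fm"
  | Conj "('f, 'r, 'v) fm" "('f, 'r, 'v) fm"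
  | Ex "('f, 'r, 'v) fm"

record ('f, 'r) lang =
  Funs :: "('f \<times> nat) set"
  Rels :: "('r \<times> nat) set"

fun wf_trm :: "('f, 'r) lang \<Rightarrow> nat \<Rightarrow> ('f, 'v) trm \<Rightarrow> bool" where
  "wf_trm L n (Var v) \<longleftrightarrow> True"
| "wf_trm L n (Bnd i) \<longleftrightarrow> i < n"
| "wf_trm L n (App f ts) \<longleftrightarrow> (f, length ts) \<in> Funs L \<and> (\<forall>t\<in>set ts. wf_trm L n t)"

fun wf_fm :: "('f, 'r) lang \<Rightarrow> nat \<Rightarrow> ('f, 'r, 'v) fm \<Rightarrow> bool" where
  "wf_fm L n (Eq t u) \<longleftrightarrow> wf_trm L n t \<and> wf_trm L n u"
| "wf_fm L n (Rel R ts) \<longleftrightarrow> (R, length ts) \<in> Rels L \<and> (\<forall>t\<in>set ts. wf_trm L n t)"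
| "wf_fm L n (Neg \<phi>) \<longleftrightarrow> wf_fm L n \<phi>"
| "wf_fm L n (Conj \<phi> \<psi>) \<longleftrightarrow> wf_fm L n \<phi> \<and> wf_fm L n \<psi>"
| "wf_fm L n (Ex \<phi>) \<longleftrightarrow> wf_fm L (Suc n) \<phi>"

text \<open>
  The \<open>L\<close>-formulas with free variables in \<open>V\<close>.  Parameters are free variables that are interpreted
  by themselves: the \<open>L(B)\<close>-formulas in the tuple of variables \<open>X\<close> are \<open>formulas L (X <+> B)\<close>,
  where \<open>Inl\<close> marks a variable and \<open>Inr\<close> a parameter.
\<close>

definition formulas :: "('f, 'r) lang \<Rightarrow> 'v set \<Rightarrow> ('f, 'r, 'v) fm set" where
  "formulas L V = {\<phi>. wf_fm L 0 \<phi> \<and> fv \<phi> \<subseteq> V}"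

record ('f, 'r, 'm) struct =
  univ :: "'m set"
  fn :: "'f \<Rightarrow> 'm list \<Rightarrow> 'm"
  rl :: "'r \<Rightarrow> 'm list \<Rightarrow> bool"

definition is_structure :: "('f, 'r) lang \<Rightarrow> ('f, 'r, 'm) struct \<Rightarrow> bool" where
  "is_structure L S \<longleftrightarrow> univ S \<noteq> {} \<and>
     (\<forall>f n ms. (f, n) \<in> Funs L \<longrightarrow> length ms = n \<longrightarrow> set ms \<subseteq> univ S \<longrightarrow> fn S f ms \<in> univ S)"

fun tval :: "('f, 'r, 'm) struct \<Rightarrow> 'm list \<Rightarrow> ('v \<Rightarrow> 'm) \<Rightarrow> ('f, 'v) trm \<Rightarrow> 'm" where
  "tval S bs e (Var v) = e v"
| "tval S bs e (Bnd i) = bs ! i"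
| "tval S bs e (App f ts) = fn S f (map (tval S bs e) ts)"

fun sat :: "('f, 'r, 'm) struct \<Rightarrow> 'm list \<Rightarrow> ('v \<Rightarrow> 'm) \<Rightarrow> ('f, 'r, 'v) fm \<Rightarrow> bool" where
  "sat S bs e (Eq t u) \<longleftrightarrow> tval S bs e t = tval S bs e u"
| "sat S bs e (Rel R ts) \<longleftrightarrow> rl S R (map (tval S bs e) ts)"
| "sat S bs e (Neg \<phi>) \<longleftrightarrow> \<not> sat S bs e \<phi>"
| "sat S bs e (Conj \<phi> \<psi>) \<longleftrightarrow> sat S bs e \<phi> \<and> sat S bs e \<psi>"
| "sat S bs e (Ex \<phi>) \<longleftrightarrow> (\<exists>m\<in>univ S. sat S (m # bs) e \<phi>)"

abbreviation holds :: "('f, 'r, 'm) struct \<Rightarrow> ('v \<Rightarrow> 'm) \<Rightarrow> ('f, 'r, 'v) fm \<Rightarrow> bool" where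
  "holds S e \<phi> \<equiv> sat S [] e \<phi>"


section \<open>Complete theories and monster models\<close>

type_synonym ('f, 'r) sentence = "('f, 'r, nat) fm"

definition is_model :: "('f, 'r) lang \<Rightarrow> ('f, 'r, 'm) struct \<Rightarrow> ('f, 'r) sentence set \<Rightarrow> bool" where
  "is_model L S T \<longleftrightarrow> is_structure L S \<and> (\<forall>\<sigma>\<in>T. \<forall>e. range e \<subseteq> univ S \<longrightarrow> holds S e \<sigma>)"

text \<open>
  In consistency and consequence below the models range over the structures whose universe is a
  subset of the type of \<open>L\<close>-sentences.  That type has at least \<open>|L| + \<aleph>\<^sub>0\<close> elements, so by downward
  Loewenheim-Skolem this is the same as letting them range over all structures.
\<close>

definition consistent_theory :: "('f, 'r) lang \<Rightarrow> ('f, 'r) sentence set \<Rightarrow> bool" where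
  "consistent_theory L T \<longleftrightarrow> (\<exists>S :: ('f, 'r, ('f, 'r) sentence) struct. is_model L S T)"

definition entails :: "('f, 'r) lang \<Rightarrow> ('f, 'r) sentence set \<Rightarrow> ('f, 'r) sentence \<Rightarrow> bool" where
  "entails L T \<sigma> \<longleftrightarrow>
     (\<forall>S :: ('f, 'r, ('f, 'r) sentence) struct. is_model L S T \<longrightarrow> is_model L S {\<sigma>})"

definition complete_theory :: "('f, 'r) lang \<Rightarrow> ('f, 'r) sentence set \<Rightarrow> bool" where
  "complete_theory L T \<longleftrightarrow> T \<subseteq> formulas L {} \<and> consistent_theory L T \<and>
     (\<forall>\<sigma>\<in>formulas L {}. entails L T \<sigma> \<or> entails L T (Neg \<sigma>))"

text \<open>
  The tuple \<open>a\<close> (only its entries \<open>a x\<close> for the variables \<open>x\<close> of the formulas matter) satisfies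
  every formula of \<open>\<Sigma>\<close>.
\<close>

definition realizes ::
    "('f, 'r, 'm) struct \<Rightarrow> ('x \<Rightarrow> 'm) \<Rightarrow> ('f, 'r, 'x + 'm) fm set \<Rightarrow> bool" where
  "realizes C a \<Sigma> \<longleftrightarrow> (\<forall>\<phi>\<in>\<Sigma>. holds C (case_sum a id) \<phi>)"

text \<open>Consistency of a set of formulas with parameters in the ambient structure \<open>C\<close>.\<close>

definition consistent :: "('f, 'r, 'm) struct \<Rightarrow> ('f, 'r, 'x + 'm) fm set \<Rightarrow> bool" where
  "consistent C \<Sigma> \<longleftrightarrow> (\<forall>\<Delta>. finite \<Delta> \<longrightarrow> \<Delta> \<subseteq> \<Sigma> \<longrightarrow> (\<exists>a. realizes C a \<Delta>))"

definition saturated :: "('f, 'r) lang \<Rightarrow> 'k rel \<Rightarrow> ('f, 'r, 'm) struct \<Rightarrow> bool" where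
  "saturated L \<mu> C \<longleftrightarrow>
     (\<forall>B (\<Sigma> :: ('f, 'r, unit + 'm) fm set).
        |B| <o \<mu> \<longrightarrow> \<Sigma> \<subseteq> formulas L (UNIV <+> B) \<longrightarrow> consistent C \<Sigma> \<longrightarrow> (\<exists>a. realizes C a \<Sigma>))"

text \<open>In the next definition the elements of \<open>B\<close> themselves serve as names of variables.\<close>

definition partial_elementary ::
    "('f, 'r) lang \<Rightarrow> ('f, 'r, 'm) struct \<Rightarrow> 'm set \<Rightarrow> ('m \<Rightarrow> 'm) \<Rightarrow> bool" where
  "partial_elementary L C B h \<longleftrightarrow> (\<forall>\<phi>\<in>formulas L B. holds C id \<phi> \<longleftrightarrow> holds C h \<phi>)"

definition automorphism ::
    "('f, 'r) lang \<Rightarrow> ('f, 'r, 'm) struct \<Rightarrow> ('m \<Rightarrow> 'm) \<Rightarrow> bool" where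
  "automorphism L C g \<longleftrightarrow> bij_betw g (univ C) (univ C) \<and>
     (\<forall>f n ms. (f, n) \<in> Funs L \<longrightarrow> length ms = n \<longrightarrow> set ms \<subseteq> univ C \<longrightarrow>
        g (fn C f ms) = fn C f (map g ms)) \<and>
     (\<forall>R n ms. (R, n) \<in> Rels L \<longrightarrow> length ms = n \<longrightarrow> set ms \<subseteq> univ C \<longrightarrow>
        (rl C R ms \<longleftrightarrow> rl C R (map g ms)))"

definition strongly_homogeneous ::
    "('f, 'r) lang \<Rightarrow> 'k rel \<Rightarrow> ('f, 'r, 'm) struct \<Rightarrow> bool" where
  "strongly_homogeneous L \<mu> C \<longleftrightarrow>
     (\<forall>B h. |B| <o \<mu> \<longrightarrow> partial_elementary L C B h \<longrightarrow>
        (\<exists>g. automorphism L C g \<and> (\<forall>b\<in>B. g b = h b)))"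

text \<open>
  A monster model of \<open>T\<close> is a \<open>\<mu>\<close>-saturated and strongly \<open>\<mu>\<close>-homogeneous model for a cardinal
  \<open>\<mu> > |L| + \<aleph>\<^sub>0\<close>; its universe is the whole type \<open>'m\<close>.  Sets, tuples, and cardinals are small if
  they are of size \<open>< \<mu>\<close>.
\<close>

definition monster_model ::
    "('f, 'r) lang \<Rightarrow> ('f, 'r) sentence set \<Rightarrow> 'k rel \<Rightarrow> ('f, 'r, 'm) struct \<Rightarrow> bool" where
  "monster_model L T \<mu> C \<longleftrightarrow>
     Card_order \<mu> \<and> natLeq <o \<mu> \<and> |Funs L| <o \<mu> \<and> |Rels L| <o \<mu> \<and>
     univ C = UNIV \<and> is_model L C T \<and> saturated L \<mu> C \<and> strongly_homogeneous L \<mu> C"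

text \<open>\<open>M\<close> is the universe of an elementary substructure of \<open>C\<close>.\<close>

definition elementary_submodel ::
    "('f, 'r) lang \<Rightarrow> ('f, 'r, 'm) struct \<Rightarrow> 'm set \<Rightarrow> bool" where
  "elementary_submodel L C M \<longleftrightarrow> M \<subseteq> univ C \<and> is_structure L (C\<lparr>univ := M\<rparr>) \<and>
     (\<forall>\<phi>\<in>formulas L M. holds (C\<lparr>univ := M\<rparr>) id \<phi> \<longleftrightarrow> holds C id \<phi>)"


section \<open>Types\<close>

definition tp :: "('f, 'r) lang \<Rightarrow> ('f, 'r, 'm) struct \<Rightarrow> 'x set \<Rightarrow> ('x \<Rightarrow> 'm) \<Rightarrow> 'm set \<Rightarrow>
    ('f, 'r, 'x + 'm) fm set" where
  "tp L C X a B = {\<phi>\<in>formulas L (X <+> B). holds C (case_sum a id) \<phi>}"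

definition complete_types :: "('f, 'r) lang \<Rightarrow> ('f, 'r, 'm) struct \<Rightarrow> 'x set \<Rightarrow> 'm set \<Rightarrow>
    ('f, 'r, 'x + 'm) fm set set" where
  "complete_types L C X B =
     {q. q \<subseteq> formulas L (X <+> B) \<and> consistent C q \<and>
         (\<forall>\<phi>\<in>formulas L (X <+> B). \<phi> \<in> q \<or> Neg \<phi> \<in> q)}"

definition restrict_type :: "('f, 'r) lang \<Rightarrow> 'x set \<Rightarrow> ('f, 'r, 'x + 'm) fm set \<Rightarrow> 'm set \<Rightarrow>
    ('f, 'r, 'x + 'm) fm set" where
  "restrict_type L X p B = p \<inter> formulas L (X <+> B)"

text \<open>
  A formula \<open>\<phi>(x, y)\<close> of \<open>L\<close> has the free variables \<open>Inl x\<close> with \<open>x \<in> X\<close> and \<open>Inr y\<close> with \<open>y \<in> Y\<close>.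
  The next two functions form \<open>\<phi>(x, b)\<close> (in the variables \<open>x\<close>) and \<open>\<phi>(a, y)\<close> (in the variables \<open>y\<close>).
\<close>

definition inst_right :: "('y \<Rightarrow> 'm) \<Rightarrow> ('f, 'r, 'x + 'y) fm \<Rightarrow> ('f, 'r, 'x + 'm) fm" where
  "inst_right b = map_fm (map_sum id b)"

definition inst_left :: "('x \<Rightarrow> 'm) \<Rightarrow> ('f, 'r, 'x + 'y) fm \<Rightarrow> ('f, 'r, 'y + 'm) fm" where
  "inst_left a = map_fm (case_sum (Inr \<circ> a) Inl)"

text \<open>
  The complete type \<open>p\<close> over \<open>A\<close> is definable over \<open>B\<close>: for every \<open>\<phi>(x, y)\<close> some
  \<open>L(B)\<close>-formula \<open>\<psi>(y)\<close> satisfies \<open>\<phi>(x, b) \<in> p \<longleftrightarrow> \<psi>(b)\<close> for all tuples \<open>b\<close> in \<open>A\<close>.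
\<close>

definition definable_over :: "('f, 'r) lang \<Rightarrow> ('f, 'r, 'm) struct \<Rightarrow> 'x set \<Rightarrow> 'm set \<Rightarrow>
    ('f, 'r, 'x + 'm) fm set \<Rightarrow> 'm set \<Rightarrow> bool" where
  "definable_over L C X A p B \<longleftrightarrow>
     (\<forall>(Y :: nat set) \<phi>. finite Y \<longrightarrow> \<phi> \<in> formulas L (X <+> Y) \<longrightarrow>
        (\<exists>\<psi>\<in>formulas L (Y <+> B). \<forall>b. b ` Y \<subseteq> A \<longrightarrow>
           (inst_right b \<phi> \<in> p \<longleftrightarrow> holds C (case_sum b id) \<psi>)))"

definition IP :: "('f, 'r) lang \<Rightarrow> ('f, 'r, 'm) struct \<Rightarrow> 'x set \<Rightarrow>
    ('f, 'r, 'x + 'm) fm set \<Rightarrow> bool" where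
  "IP L C X \<pi> \<longleftrightarrow>
     (\<exists>(Y :: nat set) \<phi> (a :: nat \<Rightarrow> 'x \<Rightarrow> 'm).
        finite Y \<and> \<phi> \<in> formulas L (X <+> Y) \<and> (\<forall>i. realizes C (a i) \<pi>) \<and>
        (\<forall>s :: nat set.
           consistent C {if i \<in> s then inst_left (a i) \<phi> else Neg (inst_left (a i) \<phi>) |i. True}))"

abbreviation NIP :: "('f, 'r) lang \<Rightarrow> ('f, 'r, 'm) struct \<Rightarrow> 'x set \<Rightarrow>
    ('f, 'r, 'x + 'm) fm set \<Rightarrow> bool" where
  "NIP L C X \<pi> \<equiv> \<not> IP L C X \<pi>"

text \<open>A type over \<open>B\<close> is called definable, without qualification, if it is definable over \<open>B\<close>.\<close>

definition stable :: "('f, 'r) lang \<Rightarrow> ('f, 'r, 'm) struct \<Rightarrow> 'k rel \<Rightarrow> 'x set \<Rightarrow> 'm set \<Rightarrow>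
    ('f, 'r, 'x + 'm) fm set \<Rightarrow> bool" where
  "stable L C \<mu> X A \<pi> \<longleftrightarrow>
     (\<forall>B q. A \<subseteq> B \<longrightarrow> |B| <o \<mu> \<longrightarrow> q \<in> complete_types L C X B \<longrightarrow> \<pi> \<subseteq> q \<longrightarrow>
        definable_over L C X B q B)"


section \<open>Indiscernible sequences and dp-rank\<close>

text \<open>
  A sequence of tuples, \<open>entry s i j\<close> being the \<open>j\<close>-th coordinate of the \<open>i\<close>-th tuple:
  \<open>i\<close> ranges over the set \<open>points s\<close>, which is strictly linearly ordered by \<open>less s\<close>, and
  \<open>j\<close> over the set \<open>coords s\<close>.
\<close>

record ('k, 'm) tuple_seq =
  points :: "'k set"
  less :: "'k rel"
  coords :: "'k set"
  entry :: "'k \<Rightarrow> 'k \<Rightarrow> 'm"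

definition infinite_sequence :: "'k rel \<Rightarrow> ('k, 'm) tuple_seq \<Rightarrow> bool" where
  "infinite_sequence \<mu> s \<longleftrightarrow>
     infinite (points s) \<and> |points s| <o \<mu> \<and> |coords s| <o \<mu> \<and>
     strict_linear_order_on (points s) (less s)"

definition elems :: "('k, 'm) tuple_seq \<Rightarrow> 'm set" where
  "elems s = {entry s i j |i j. i \<in> points s \<and> j \<in> coords s}"

definition increasing :: "('k, 'm) tuple_seq \<Rightarrow> nat \<Rightarrow> (nat \<Rightarrow> 'k) \<Rightarrow> bool" where
  "increasing s n i \<longleftrightarrow> (\<forall>k<n. i k \<in> points s) \<and> (\<forall>k l. k < l \<longrightarrow> l < n \<longrightarrow> (i k, i l) \<in> less s)"

text \<open>The variable \<open>(k, j)\<close> stands for the \<open>j\<close>-th coordinate of the \<open>k\<close>-th of \<open>n\<close> tuples.\<close>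

definition indiscernible ::
    "('f, 'r) lang \<Rightarrow> ('f, 'r, 'm) struct \<Rightarrow> 'm set \<Rightarrow> ('k, 'm) tuple_seq \<Rightarrow> bool" where
  "indiscernible L C B s \<longleftrightarrow>
     (\<forall>n i i'. increasing s n i \<longrightarrow> increasing s n i' \<longrightarrow>
        (\<forall>\<phi>\<in>formulas L (({..<n} \<times> coords s) <+> B).
           holds C (case_sum (\<lambda>(k, j). entry s (i k) j) id) \<phi> \<longleftrightarrow>
           holds C (case_sum (\<lambda>(k, j). entry s (i' k) j) id) \<phi>))"

definition mutually_indiscernible :: "('f, 'r) lang \<Rightarrow> ('f, 'r, 'm) struct \<Rightarrow> 'm set \<Rightarrow>
    'i set \<Rightarrow> ('i \<Rightarrow> ('k, 'm) tuple_seq) \<Rightarrow> bool" where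
  "mutually_indiscernible L C A K I \<longleftrightarrow>
     (\<forall>\<alpha>\<in>K. indiscernible L C (A \<union> (\<Union>\<beta>\<in>K - {\<alpha>}. elems (I \<beta>))) (I \<alpha>))"

text \<open>
  \<open>dpr(\<Sigma>) < \<kappa>\<close> for a partial type \<open>\<Sigma>\<close> over \<open>A\<close>; the cardinal \<open>\<kappa>\<close> is a cardinal order, and
  families of length \<open>\<kappa>\<close> are indexed by its field.
\<close>

definition dpr_less :: "('f, 'r) lang \<Rightarrow> ('f, 'r, 'm) struct \<Rightarrow> 'k rel \<Rightarrow> 'x set \<Rightarrow> 'm set \<Rightarrow>
    ('f, 'r, 'x + 'm) fm set \<Rightarrow> 'k rel \<Rightarrow> bool" where
  "dpr_less L C \<mu> X A \<Sigma> \<kappa> \<longleftrightarrow>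
     (\<forall>(I :: 'k \<Rightarrow> ('k, 'm) tuple_seq) b.
        (\<forall>\<alpha>\<in>Field \<kappa>. infinite_sequence \<mu> (I \<alpha>)) \<longrightarrow>
        mutually_indiscernible L C A (Field \<kappa>) I \<longrightarrow>
        realizes C b \<Sigma> \<longrightarrow>
        (\<exists>\<beta>\<in>Field \<kappa>. indiscernible L C (b ` X \<union> A) (I \<beta>)))"

text \<open>
  \<open>dpr(\<Sigma>) = dpr(\<Sigma>')\<close> for \<open>\<Sigma>\<close> over \<open>A\<close> and \<open>\<Sigma>'\<close> over \<open>A'\<close>.  All small cardinals occur as \<open>\<kappa>\<close>,
  since \<open>\<kappa>\<close> lives on the same type as \<open>\<mu>\<close>.
\<close>

definition dpr_eq :: "('f, 'r) lang \<Rightarrow> ('f, 'r, 'm) struct \<Rightarrow> 'k rel \<Rightarrow> 'x set \<Rightarrow>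
    'm set \<Rightarrow> ('f, 'r, 'x + 'm) fm set \<Rightarrow> 'm set \<Rightarrow> ('f, 'r, 'x + 'm) fm set \<Rightarrow> bool" where
  "dpr_eq L C \<mu> X A \<Sigma> A' \<Sigma>' \<longleftrightarrow>
     (\<forall>\<kappa> :: 'k rel. Card_order \<kappa> \<longrightarrow> \<kappa> <o \<mu> \<longrightarrow>
        (dpr_less L C \<mu> X A \<Sigma> \<kappa> \<longleftrightarrow> dpr_less L C \<mu> X A' \<Sigma>' \<kappa>))"

end

theory Submission
  imports Defs
begin

text \<open>
  A type \<open>p\<close> over \<open>A\<close> that is definable over a model \<open>M \<subseteq> A\<close> is an heir of \<open>p\<restriction>M\<close>: if
  \<open>\<chi>(x, c) \<in> p\<close> and \<open>Q(c)\<close> holds for a formula \<open>Q\<close> over \<open>M\<close>, then already some \<open>c'\<close> in \<open>M\<close> satisfies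
  \<open>Q\<close> together with the formula over \<open>M\<close> that defines \<open>\<chi>(x, _) \<in> p\<close>, whence \<open>\<chi>(x, c') \<in> p\<restriction>M\<close>.
  By compactness, any small tuple \<open>e\<close> has a copy \<open>e'\<close> of the same type over \<open>M\<close> such that the type of
  \<open>A\<close> over \<open>M e'\<close> is finitely satisfiable in \<open>M\<close> (lemma \<open>coheir_copy_exists\<close>).  Whatever holds of
  \<open>e\<close> for all parameters in \<open>M\<close> then holds of \<open>e'\<close> for all parameters in \<open>A\<close>, and those parts of
  \<open>e\<close> that realize \<open>p\<restriction>M\<close> become realizations of \<open>p\<close> (lemma \<open>coheir_copy_realizes\<close>).

  Two parts of the theorem are obtained by copying a counterexample.  If realizations \<open>a\<^sub>i\<close> of \<open>p\<restriction>M\<close>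
  witness IP, so do their copies, which realize \<open>p\<close> (lemma \<open>IP_definable_extension\<close>).  If \<open>b\<close> realizes
  \<open>p\<restriction>M\<close> and \<open>\<kappa>\<close> sequences are mutually indiscernible over \<open>M\<close>, none of them indiscernible over
  \<open>b M\<close>, then their copies are mutually indiscernible even over \<open>A\<close>, so that \<open>dpr(p) \<ge> \<kappa>\<close>
  (lemma \<open>dpr_less_restrict\<close>).  The other inequality between the dp-ranks is the independence of the
  dp-rank from the set of parameters: parameters can be absorbed into the sequences (lemma
  \<open>dpr_less_extension\<close>).

  Stability is handled through Shelah's local rank, the height of binary trees of instances of a
  formula \<open>\<phi>(x, y)\<close>.  If some formula of \<open>p\<restriction>M\<close> has no such tree of height \<open>n\<close>, then every complete
  extension of \<open>p\<restriction>M\<close> has a definition for \<open>\<phi>\<close>, expressed by the rank (lemma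
  \<open>definable_if_bounded_trees\<close>); the absence of a tree passes from \<open>p\<close> to \<open>p\<restriction>M\<close> because \<open>p\<close> is an
  heir (lemma \<open>bounded_trees_restrict\<close>); and if all formulas of \<open>p\<close> had trees of all heights, an
  extension of \<open>p\<close> that is not definable could be built by diagonalizing against all possible
  definitions (lemma \<open>stable_imp_bounded_trees\<close>).
\<close>

section \<open>Substitution, binding and conjunction of formulas\<close>

lemma tval_map: "tval S bs e (map_trm f t) = tval S bs (e \<circ> f) t"
  by (induction t) (auto intro!: arg_cong[where f = "fn S _"])

lemma sat_map: "sat S bs e (map_fm f \<phi>) \<longleftrightarrow> sat S bs (e \<circ> f) \<phi>"
  by (induction \<phi> arbitrary: bs) (auto simp: tval_map comp_def)

lemma wf_trm_map: "wf_trm L n (map_trm f t) \<longleftrightarrow> wf_trm L n t"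
  by (induction t) auto

lemma wf_fm_map: "wf_fm L n (map_fm f \<phi>) \<longleftrightarrow> wf_fm L n \<phi>"
  by (induction \<phi> arbitrary: n) (auto simp: wf_trm_map)

lemma map_formulas: "map_fm f \<phi> \<in> formulas L V \<longleftrightarrow> \<phi> \<in> formulas L UNIV \<and> f ` fv \<phi> \<subseteq> V"
  by (auto simp: formulas_def wf_fm_map fm.set_map)

lemma map_formulasI: "\<phi> \<in> formulas L U \<Longrightarrow> f ` U \<subseteq> V \<Longrightarrow> map_fm f \<phi> \<in> formulas L V"
  by (auto simp: formulas_def wf_fm_map fm.set_map)

lemma tval_cong: "(\<And>v. v \<in> tfv t \<Longrightarrow> e v = e' v) \<Longrightarrow> tval S bs e t = tval S bs e' t"
proof (induction t)
  case (App f ts)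
  have "tval S bs e t = tval S bs e' t" if "t \<in> set ts" for t
    using that App by auto
  then have "map (tval S bs e) ts = map (tval S bs e') ts"
    by simp
  then show ?case by (simp only: tval.simps)
qed simp_all

lemma sat_cong: "(\<And>v. v \<in> fv \<phi> \<Longrightarrow> e v = e' v) \<Longrightarrow> sat S bs e \<phi> \<longleftrightarrow> sat S bs e' \<phi>"
proof (induction \<phi> arbitrary: bs)
  case (Eq t u)
  then have "tval S bs e t = tval S bs e' t" "tval S bs e u = tval S bs e' u"
    by (auto intro!: tval_cong)
  then show ?case by simp
next
  case (Rel R ts)
  then have "map (tval S bs e) ts = map (tval S bs e') ts"
    by (auto intro!: tval_cong)
  then show ?case by (simp only: sat.simps)
qed auto

lemma formulas_mono: "\<phi> \<in> formulas L U \<Longrightarrow> U \<subseteq> V \<Longrightarrow> \<phi> \<in> formulas L V"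
  by (auto simp: formulas_def)

lemma finite_tfv: "finite (tfv t)"
  by (induction t) auto

lemma finite_fv: "finite (fv \<phi>)"
  by (induction \<phi>) (auto simp: finite_tfv)

lemma Neg_formulas [simp]: "Neg \<phi> \<in> formulas L V \<longleftrightarrow> \<phi> \<in> formulas L V"
  by (simp add: formulas_def)

lemma Conj_formulas [simp]:
  "Conj \<phi> \<psi> \<in> formulas L V \<longleftrightarrow> \<phi> \<in> formulas L V \<and> \<psi> \<in> formulas L V"
  by (auto simp: formulas_def)

text \<open>
  A free variable is turned into the outermost bound one; at quantifier depth \<open>n\<close> the index of
  the latter is \<open>n\<close>.
\<close>

fun bind_trm :: "nat \<Rightarrow> 'v \<Rightarrow> ('f, 'v) trm \<Rightarrow> ('f, 'v) trm" where
  "bind_trm n v (Var w) = (if w = v then Bnd n else Var w)"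
| "bind_trm n v (Bnd i) = Bnd i"
| "bind_trm n v (App f ts) = App f (map (bind_trm n v) ts)"

fun bind_fm :: "nat \<Rightarrow> 'v \<Rightarrow> ('f, 'r, 'v) fm \<Rightarrow> ('f, 'r, 'v) fm" where
  "bind_fm n v (Eq t u) = Eq (bind_trm n v t) (bind_trm n v u)"
| "bind_fm n v (Rel R ts) = Rel R (map (bind_trm n v) ts)"
| "bind_fm n v (Neg \<phi>) = Neg (bind_fm n v \<phi>)"
| "bind_fm n v (Conj \<phi> \<psi>) = Conj (bind_fm n v \<phi>) (bind_fm n v \<psi>)"
| "bind_fm n v (Ex \<phi>) = Ex (bind_fm (Suc n) v \<phi>)"

lemma wf_bind_trm: "wf_trm L n t \<Longrightarrow> wf_trm L (Suc n) (bind_trm n v t)"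
  by (induction t) auto

lemma wf_bind_fm: "wf_fm L n \<phi> \<Longrightarrow> wf_fm L (Suc n) (bind_fm n v \<phi>)"
  by (induction \<phi> arbitrary: n) (auto simp: wf_bind_trm)

lemma tfv_bind_trm: "tfv (bind_trm n v t) = tfv t - {v}"
  by (induction t) auto

lemma fv_bind_fm: "fv (bind_fm n v \<phi>) = fv \<phi> - {v}"
  by (induction \<phi> arbitrary: n) (auto simp: tfv_bind_trm)

lemma tval_bind_trm:
  "wf_trm L (length bs) t \<Longrightarrow> tval S (bs @ [m]) e (bind_trm (length bs) v t) = tval S bs (e(v := m)) t"
  by (induction t) (auto simp: nth_append intro!: arg_cong[where f = "fn S _"])

lemma sat_bind_fm:
  "wf_fm L (length bs) \<phi> \<Longrightarrow> sat S (bs @ [m]) e (bind_fm (length bs) v \<phi>) \<longleftrightarrow> sat S bs (e(v := m)) \<phi>"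
proof (induction \<phi> arbitrary: bs)
  case (Rel R ts)
  then have "map (tval S (bs @ [m]) e \<circ> bind_trm (length bs) v) ts = map (tval S bs (e(v := m))) ts"
    by (auto intro!: tval_bind_trm)
  then show ?case by (simp only: bind_fm.simps sat.simps map_map)
next
  case (Ex \<phi>)
  from Ex.IH[of "_ # bs"] Ex.prems show ?case by simp
qed (auto simp: tval_bind_trm)

definition Exists :: "'v \<Rightarrow> ('f, 'r, 'v) fm \<Rightarrow> ('f, 'r, 'v) fm" where
  "Exists v \<phi> = Ex (bind_fm 0 v \<phi>)"

lemma Exists_formulas: "\<phi> \<in> formulas L V \<Longrightarrow> Exists v \<phi> \<in> formulas L (V - {v})"
  by (auto simp: formulas_def Exists_def wf_bind_fm fv_bind_fm)

lemma holds_Exists: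
  "\<phi> \<in> formulas L V \<Longrightarrow> holds S e (Exists v \<phi>) \<longleftrightarrow> (\<exists>m\<in>univ S. holds S (e(v := m)) \<phi>)"
  using sat_bind_fm[of L "[]" \<phi> S _ e v] by (auto simp: formulas_def Exists_def)

definition Truth :: "('f, 'r, 'v) fm" where
  "Truth = Neg (Ex (Neg (Eq (Bnd 0) (Bnd 0))))"

lemma Truth_formulas [simp]: "Truth \<in> formulas L V"
  by (simp add: formulas_def Truth_def)

lemma holds_Truth [simp]: "holds S e Truth"
  by (simp add: Truth_def)

lemma finite_conjunction:
  assumes "finite \<Delta>" "\<Delta> \<subseteq> formulas L V"
  obtains \<theta> where "\<theta> \<in> formulas L V" "\<And>e. holds S e \<theta> \<longleftrightarrow> (\<forall>\<phi>\<in>\<Delta>. holds S e \<phi>)"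
proof -
  from assms have "\<exists>\<theta>\<in>formulas L V. \<forall>e. holds S e \<theta> \<longleftrightarrow> (\<forall>\<phi>\<in>\<Delta>. holds S e \<phi>)"
  proof (induction \<Delta>)
    case empty
    show ?case by (rule bexI[of _ Truth]) auto
  next
    case (insert \<phi> \<Delta>)
    then obtain \<theta> where \<theta>: "\<theta> \<in> formulas L V" "\<forall>e. holds S e \<theta> \<longleftrightarrow> (\<forall>\<phi>\<in>\<Delta>. holds S e \<phi>)"
      by auto
    with insert.prems show ?case by (intro bexI[of _ "Conj \<phi> \<theta>"]) auto
  qed
  then show thesis using that by blast
qed


section \<open>Expressible predicates\<close>

text \<open>
  Reasoning about the predicates that formulas express, instead of about the formulas, makes the
  connectives and quantifiers those of the metalanguage.
\<close>

definition expressible ::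
    "('f, 'r) lang \<Rightarrow> ('f, 'r, 'm) struct \<Rightarrow> 'v set \<Rightarrow> (('v \<Rightarrow> 'm) \<Rightarrow> bool) \<Rightarrow> bool" where
  "expressible L C V Q \<longleftrightarrow> (\<exists>\<phi>\<in>formulas L V. \<forall>e. holds C e \<phi> \<longleftrightarrow> Q e)"

lemma expressible_holds: "\<phi> \<in> formulas L V \<Longrightarrow> expressible L C V (\<lambda>e. holds C e \<phi>)"
  by (auto simp: expressible_def)

lemma expressible_cong: "expressible L C V Q \<Longrightarrow> (\<And>v. v \<in> V \<Longrightarrow> e v = e' v) \<Longrightarrow> Q e \<longleftrightarrow> Q e'"
  unfolding expressible_def formulas_def using sat_cong[of _ e e' C "[]"] by blast

lemma expressible_mono: "expressible L C U Q \<Longrightarrow> U \<subseteq> V \<Longrightarrow> expressible L C V Q"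
  unfolding expressible_def using formulas_mono by blast

lemma expressible_neg: "expressible L C V Q \<Longrightarrow> expressible L C V (\<lambda>e. \<not> Q e)"
  unfolding expressible_def by (metis Neg_formulas sat.simps(3))

lemma expressible_conj:
  "expressible L C V Q \<Longrightarrow> expressible L C V R \<Longrightarrow> expressible L C V (\<lambda>e. Q e \<and> R e)"
  unfolding expressible_def by (metis Conj_formulas sat.simps(4))

lemma expressible_const: "expressible L C V (\<lambda>e. b)"
  unfolding expressible_def
  by (cases b) (auto intro: bexI[of _ Truth] bexI[of _ "Neg Truth"])

lemma expressible_imp:
  "expressible L C V Q \<Longrightarrow> expressible L C V R \<Longrightarrow> expressible L C V (\<lambda>e. Q e \<longrightarrow> R e)"
  using expressible_neg[OF expressible_conj[OF _ expressible_neg], of L C V Q R] by simp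

lemma expressible_iff:
  "expressible L C V Q \<Longrightarrow> expressible L C V R \<Longrightarrow> expressible L C V (\<lambda>e. Q e \<longleftrightarrow> R e)"
  using expressible_conj[OF expressible_imp expressible_imp, of L C V Q R R Q]
  by (simp add: iff_conv_conj_imp)

lemma expressible_finite_ball:
  assumes "finite I" "\<And>i. i \<in> I \<Longrightarrow> expressible L C V (Q i)"
  shows "expressible L C V (\<lambda>e. \<forall>i\<in>I. Q i e)"
  using assms by (induction I) (auto intro: expressible_conj expressible_const)

lemma expressible_rename:
  assumes "expressible L C U Q" "f ` U \<subseteq> V"
  shows "expressible L C V (\<lambda>e. Q (e \<circ> f))"
  using assms unfolding expressible_def by (metis map_formulasI sat_map)

text \<open>
  Quantification over all variables outside \<open>W\<close> is first-order, even when there are infinitely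
  many of them, because only those that occur in the formula matter.
\<close>

lemma expressible_project:
  assumes "univ C = UNIV" and "expressible L C U Q"
  shows "expressible L C (U \<inter> W) (\<lambda>e. \<exists>e'. (\<forall>v\<in>W. e' v = e v) \<and> Q e')"
proof -
  from assms(2) obtain \<phi> where \<phi>: "\<phi> \<in> formulas L U" and Q: "\<And>e. holds C e \<phi> \<longleftrightarrow> Q e"
    by (auto simp: expressible_def)
  have "\<exists>\<psi>\<in>formulas L (fv \<phi> - F). \<forall>e. holds C e \<psi> \<longleftrightarrow> (\<exists>e'. (\<forall>v. v \<notin> F \<longrightarrow> e' v = e v) \<and> holds C e' \<phi>)"
    if "finite F" for F
    using that
  proof (induction F)
    case empty
    have "\<And>e e'. (\<forall>v. e' v = e v) = (e' = e)" by (auto simp: fun_eq_iff)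
    then show ?case using \<phi> by (intro bexI[of _ \<phi>]) (auto simp: formulas_def)
  next
    case (insert v F)
    then obtain \<psi> where \<psi>: "\<psi> \<in> formulas L (fv \<phi> - F)"
      "\<And>e. holds C e \<psi> \<longleftrightarrow> (\<exists>e'. (\<forall>v. v \<notin> F \<longrightarrow> e' v = e v) \<and> holds C e' \<phi>)"
      by blast
    have "(\<exists>m e'. (\<forall>w. w \<notin> F \<longrightarrow> e' w = (e(v := m)) w) \<and> holds C e' \<phi>) \<longleftrightarrow>
        (\<exists>e'. (\<forall>w. w \<notin> insert v F \<longrightarrow> e' w = e w) \<and> holds C e' \<phi>)" for e
    proof
      assume "\<exists>e'. (\<forall>w. w \<notin> insert v F \<longrightarrow> e' w = e w) \<and> holds C e' \<phi>"
      then obtain e' where "\<forall>w. w \<notin> insert v F \<longrightarrow> e' w = e w" "holds C e' \<phi>" by blast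
      then show "\<exists>m e'. (\<forall>w. w \<notin> F \<longrightarrow> e' w = (e(v := m)) w) \<and> holds C e' \<phi>"
        by (intro exI[of _ "e' v"] exI[of _ e']) auto
    next
      assume "\<exists>m e'. (\<forall>w. w \<notin> F \<longrightarrow> e' w = (e(v := m)) w) \<and> holds C e' \<phi>"
      then obtain m e' where "\<forall>w. w \<notin> F \<longrightarrow> e' w = (e(v := m)) w" "holds C e' \<phi>" by blast
      then show "\<exists>e'. (\<forall>w. w \<notin> insert v F \<longrightarrow> e' w = e w) \<and> holds C e' \<phi>"
        by (intro exI[of _ e']) auto
    qed
    then show ?case
      using Exists_formulas[OF \<psi>(1), of v] holds_Exists[OF \<psi>(1), of C _ v] \<psi>(2) assms(1)
      by (intro bexI[of _ "Exists v \<psi>"]) (auto elim: formulas_mono)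
  qed
  from this[of "fv \<phi> - W"] obtain \<psi> where \<psi>: "\<psi> \<in> formulas L (fv \<phi> - (fv \<phi> - W))"
    "\<And>e. holds C e \<psi> \<longleftrightarrow> (\<exists>e'. (\<forall>v. v \<notin> fv \<phi> - W \<longrightarrow> e' v = e v) \<and> holds C e' \<phi>)"
    using finite_fv by blast
  have "(\<exists>e'. (\<forall>v. v \<notin> fv \<phi> - W \<longrightarrow> e' v = e v) \<and> holds C e' \<phi>) \<longleftrightarrow> (\<exists>e'. (\<forall>v\<in>W. e' v = e v) \<and> Q e')" for e
  proof
    assume "\<exists>e'. (\<forall>v\<in>W. e' v = e v) \<and> Q e'"
    then obtain e' where e': "\<forall>v\<in>W. e' v = e v" "Q e'" by blast
    define e'' where "e'' = (\<lambda>v. if v \<in> fv \<phi> then e' v else e v)"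
    have "holds C e'' \<phi> \<longleftrightarrow> holds C e' \<phi>" by (rule sat_cong) (simp add: e''_def)
    then have "(\<forall>v. v \<notin> fv \<phi> - W \<longrightarrow> e'' v = e v) \<and> holds C e'' \<phi>"
      using e' Q by (auto simp: e''_def)
    then show "\<exists>e'. (\<forall>v. v \<notin> fv \<phi> - W \<longrightarrow> e' v = e v) \<and> holds C e' \<phi>" by blast
  next
    assume "\<exists>e'. (\<forall>v. v \<notin> fv \<phi> - W \<longrightarrow> e' v = e v) \<and> holds C e' \<phi>"
    then show "\<exists>e'. (\<forall>v\<in>W. e' v = e v) \<and> Q e'" using Q by blast
  qed
  with \<psi>(2) have "\<forall>e. holds C e \<psi> \<longleftrightarrow> (\<exists>e'. (\<forall>v\<in>W. e' v = e v) \<and> Q e')" by simp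
  moreover have "\<psi> \<in> formulas L (U \<inter> W)"
    using \<psi>(1) \<phi> by (auto simp: formulas_def)
  ultimately show ?thesis
    unfolding expressible_def by blast
qed


section \<open>Small sets and saturation for infinite tuples\<close>

locale monster =
  fixes L :: "('f, 'r) lang" and T :: "('f, 'r) sentence set" and \<mu> :: "'k rel"
    and C :: "('f, 'r, 'm) struct"
  assumes monster: "monster_model L T \<mu> C"
begin

abbreviation small :: "'s set \<Rightarrow> bool" where
  "small S \<equiv> |S| <o \<mu>"

lemma univ_C [simp]: "univ C = UNIV"
  using monster by (simp add: monster_model_def)

lemma Card_order_\<mu>: "Card_order \<mu>" and natLeq_less_\<mu>: "natLeq <o \<mu>"
  using monster by (simp_all add: monster_model_def)

lemma infinite_Field_\<mu>: "infinite (Field \<mu>)"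
  using natLeq_less_\<mu> Card_order_\<mu>
  by (metis card_of_Field_ordIso finite_iff_ordLess_natLeq not_ordLess_ordIso ordIso_iff_ordLeq
      ordIso_ordLess_trans ordLess_transitive)

lemma small_nat: "small (UNIV :: nat set)"
  using natLeq_less_\<mu> card_of_nat ordIso_ordLess_trans by blast

lemma small_finite: "finite S \<Longrightarrow> small S"
  using finite_iff_ordLess_natLeq natLeq_less_\<mu> ordLess_transitive by blast

lemma small_subset: "small S \<Longrightarrow> R \<subseteq> S \<Longrightarrow> small R"
  using card_of_mono1 ordLeq_ordLess_trans by blast

lemma small_image: "small S \<Longrightarrow> small (f ` S)"
  using card_of_image ordLeq_ordLess_trans by blast

lemma small_Plus: "small R \<Longrightarrow> small S \<Longrightarrow> small (R <+> S)"
  using card_of_Plus_ordLess_infinite_Field[OF infinite_Field_\<mu> Card_order_\<mu>] .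

lemma small_Un: "small R \<Longrightarrow> small S \<Longrightarrow> small (R \<union> S)"
  using card_of_Un_ordLess_infinite_Field[OF infinite_Field_\<mu> Card_order_\<mu>] .

lemma small_Times:
  assumes "small (R :: 'a set)" "small (S :: 'b set)"
  shows "small (R \<times> S)"
proof -
  let ?Z = "R <+> S <+> (UNIV :: nat set)"
  have "infinite ?Z" by (simp add: finite_Plus_iff)
  have "R \<times> S \<subseteq> (\<lambda>(u, v). (case u of Inl r \<Rightarrow> r, case v of Inr (Inl s) \<Rightarrow> s)) ` (?Z \<times> ?Z)"
    by (force simp: image_iff)
  moreover have "small (?Z \<times> ?Z)"
    using card_of_Times_same_infinite[OF \<open>infinite ?Z\<close>] small_Plus[OF assms(1) small_Plus[OF assms(2) small_nat]]
      ordIso_ordLess_trans by blast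
  ultimately show ?thesis using small_image small_subset by metis
qed

text \<open>
  Zorn's lemma is applied to the partial assignments \<open>G\<close> that stay compatible with every finite
  part of the given set of formulas; being compatible with \<open>{}\<close> makes \<open>G\<close> single-valued.  A
  maximal \<open>G\<close> is total, since the constraints on one more variable form a consistent set of
  formulas over \<open>B\<close> and the values of \<open>G\<close>.
\<close>

lemma small_tuple_saturation:
  fixes V :: "'v set" and B :: "'m set"
  assumes V: "small V" and B: "small B" and \<Sigma>: "\<Sigma> \<subseteq> formulas L (V <+> B)" and "consistent C \<Sigma>"
  shows "\<exists>e. realizes C e \<Sigma>"
proof -
  define ok where "ok G \<longleftrightarrow> Domain G \<subseteq> V \<and>
      (\<forall>\<Delta>. finite \<Delta> \<longrightarrow> \<Delta> \<subseteq> \<Sigma> \<longrightarrow> (\<exists>e. realizes C e \<Delta> \<and> (\<forall>v m. (v, m) \<in> G \<longrightarrow> e v = m)))"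
    for G :: "('v \<times> 'm) set"
  have okD: "\<exists>e. realizes C e \<Delta> \<and> (\<forall>v m. (v, m) \<in> G \<longrightarrow> e v = m)" if "ok G" "finite \<Delta>" "\<Delta> \<subseteq> \<Sigma>" for G \<Delta>
    using that by (simp add: ok_def)
  have single: "m = m'" if "ok G" "(v, m) \<in> G" "(v, m') \<in> G" for G v m m'
  proof -
    from okD[OF that(1), of "{}"] obtain e where "\<forall>v m. (v, m) \<in> G \<longrightarrow> e v = m" by auto
    with that(2,3) show ?thesis by auto
  qed
  have "\<exists>G\<in>{G. ok G}. \<forall>H\<in>{G. ok G}. G \<subseteq> H \<longrightarrow> H = G"
  proof (rule subset_Zorn_nonempty)
    have "ok {}" using assms(4) by (auto simp: ok_def consistent_def)
    then show "{G. ok G} \<noteq> {}" by blast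
  next
    fix \<C> assume "\<C> \<noteq> {}" and chain: "subset.chain {G. ok G} \<C>"
    have member: "\<exists>H\<in>\<C>. F \<subseteq> H" if "finite F" "F \<subseteq> \<Union>\<C>" for F
      using finite_subset_Union_chain[OF that \<open>\<C> \<noteq> {}\<close> chain] by blast
    have ok_member: "ok H" if "H \<in> \<C>" for H
      using chain that by (auto simp: subset_chain_def)
    have single': "m = m'" if "(v, m) \<in> \<Union>\<C>" "(v, m') \<in> \<Union>\<C>" for v m m'
    proof -
      from that have "{(v, m), (v, m')} \<subseteq> \<Union>\<C>" by blast
      from member[OF _ this] obtain H where "H \<in> \<C>" "{(v, m), (v, m')} \<subseteq> H" by auto
      then show ?thesis using single[OF ok_member] by auto
    qed
    define g where "g v = (THE m. (v, m) \<in> \<Union>\<C>)" for v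
    have g: "g v = m" if "(v, m) \<in> \<Union>\<C>" for v m
      unfolding g_def using that single' by blast
    have "\<exists>e. realizes C e \<Delta> \<and> (\<forall>v m. (v, m) \<in> \<Union>\<C> \<longrightarrow> e v = m)" if "finite \<Delta>" "\<Delta> \<subseteq> \<Sigma>" for \<Delta>
    proof -
      define F where "F = {v. \<exists>\<phi>\<in>\<Delta>. Inl v \<in> fv \<phi>}"
      have "finite (\<Union> (fv ` \<Delta>))" using \<open>finite \<Delta>\<close> by (simp add: finite_fv)
      then have "finite (Inl -` \<Union> (fv ` \<Delta>) :: 'v set)" by (rule finite_vimageI) simp
      moreover have "F \<subseteq> Inl -` \<Union> (fv ` \<Delta>)" by (auto simp: F_def)
      ultimately have "finite F" by (rule finite_subset[rotated])
      let ?G = "{(v, m). v \<in> F \<and> (v, m) \<in> \<Union>\<C>}"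
      have "?G \<subseteq> (\<lambda>v. (v, g v)) ` F" using g by auto
      then have "finite ?G" using \<open>finite F\<close> finite_subset by blast
      then obtain H where "H \<in> \<C>" and H: "?G \<subseteq> H" using member[of ?G] by blast
      note okH = ok_member[OF \<open>H \<in> \<C>\<close>]
      from okD[OF okH that]
      obtain e where e: "realizes C e \<Delta>" "\<forall>v m. (v, m) \<in> H \<longrightarrow> e v = m" by blast
      define e' where "e' v = (if v \<in> Domain (\<Union>\<C>) then g v else e v)" for v
      have "e' v = e v" if "v \<in> F" for v
        using that H e(2) g by (fastforce simp: e'_def)
      then have "holds C (case_sum e' id) \<phi> \<longleftrightarrow> holds C (case_sum e id) \<phi>" if "\<phi> \<in> \<Delta>" for \<phi>
        using that by (intro sat_cong) (auto simp: F_def split: sum.split)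
      then have "realizes C e' \<Delta>" using e(1) by (simp add: realizes_def)
      moreover have "\<forall>v m. (v, m) \<in> \<Union>\<C> \<longrightarrow> e' v = m" using g by (auto simp: e'_def)
      ultimately show ?thesis by blast
    qed
    moreover have "Domain (\<Union>\<C>) \<subseteq> V" using ok_member by (fastforce simp: ok_def)
    ultimately show "\<Union>\<C> \<in> {G. ok G}" by (auto simp: ok_def)
  qed
  then obtain G where "ok G" and max: "\<And>H. ok H \<Longrightarrow> G \<subseteq> H \<Longrightarrow> H = G" by blast
  define g where "g v = (THE m. (v, m) \<in> G)" for v
  have g: "g v = m" if "(v, m) \<in> G" for v m
    unfolding g_def using that single[OF \<open>ok G\<close>] by blast
  have "V \<subseteq> Domain G"
  proof (rule ccontr)
    assume "\<not> V \<subseteq> Domain G"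
    then obtain v where v: "v \<in> V" "v \<notin> Domain G" by blast
    let ?B = "B \<union> Range G"
    define E where "E \<Delta> m \<longleftrightarrow> (\<exists>e. realizes C e \<Delta> \<and> (\<forall>v m. (v, m) \<in> G \<longrightarrow> e v = m) \<and> e v = m)" for \<Delta> m
    have "\<exists>\<chi>\<in>formulas L (UNIV <+> ?B). \<forall>x :: unit \<Rightarrow> 'm. holds C (case_sum x id) \<chi> \<longleftrightarrow> E \<Delta> (x ())"
      if "finite \<Delta>" "\<Delta> \<subseteq> \<Sigma>" for \<Delta>
    proof -
      from that \<Sigma> obtain \<theta> where \<theta>: "\<theta> \<in> formulas L (V <+> B)"
        "\<And>e. holds C e \<theta> \<longleftrightarrow> (\<forall>\<phi>\<in>\<Delta>. holds C e \<phi>)"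
        by (meson finite_conjunction subset_trans)
      define W :: "('v + 'm) set" where "W = Inl ` insert v (Domain G) \<union> range Inr"
      define f :: "'v + 'm \<Rightarrow> unit + 'm"
        where "f = case_sum (\<lambda>w. if w = v then Inl () else Inr (g w)) Inr"
      have "f ` ((V <+> B) \<inter> W) \<subseteq> UNIV <+> ?B"
        using g by (fastforce simp: f_def W_def)
      from expressible_rename[OF expressible_project[OF univ_C expressible_holds[OF \<theta>(1)]] this]
      obtain \<chi> where \<chi>: "\<chi> \<in> formulas L (UNIV <+> ?B)"
        "\<And>x. holds C x \<chi> \<longleftrightarrow> (\<exists>e'. (\<forall>w\<in>W. e' w = (x \<circ> f) w) \<and> holds C e' \<theta>)"
        unfolding expressible_def by blast
      have "holds C (case_sum x id) \<chi> \<longleftrightarrow> E \<Delta> (x ())" for x :: "unit \<Rightarrow> 'm"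
      proof
        assume "holds C (case_sum x id) \<chi>"
        then obtain e' where e': "\<forall>w\<in>W. e' w = (case_sum x id \<circ> f) w" "holds C e' \<theta>"
          using \<chi>(2) by blast
        have "e' = case_sum (e' \<circ> Inl) id"
          using e'(1) by (auto simp: fun_eq_iff W_def f_def split: sum.split)
        with e'(2) \<theta>(2) have "realizes C (e' \<circ> Inl) \<Delta>" by (metis realizes_def)
        moreover have "(e' \<circ> Inl) v = x ()"
          using e'(1) by (simp add: W_def f_def)
        moreover have "(e' \<circ> Inl) w = m" if "(w, m) \<in> G" for w m
        proof -
          have "w \<noteq> v" "Inl w \<in> W" using that v(2) by (auto simp: W_def)
          then show ?thesis using e'(1) g[OF that] by (simp add: f_def)
        qed
        ultimately show "E \<Delta> (x ())" unfolding E_def by blast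
      next
        assume "E \<Delta> (x ())"
        then obtain e where e: "realizes C e \<Delta>" "\<forall>w m. (w, m) \<in> G \<longrightarrow> e w = m" "e v = x ()"
          unfolding E_def by blast
        have "\<forall>w\<in>W. case_sum e id w = (case_sum x id \<circ> f) w"
          using e(2,3) g by (fastforce simp: W_def f_def)
        then show "holds C (case_sum x id) \<chi>"
          using e(1) \<theta>(2) \<chi>(2) by (auto simp: realizes_def)
      qed
      with \<chi>(1) show ?thesis by blast
    qed
    then obtain \<chi> where \<chi>: "\<And>\<Delta>. finite \<Delta> \<Longrightarrow> \<Delta> \<subseteq> \<Sigma> \<Longrightarrow> \<chi> \<Delta> \<in> formulas L (UNIV <+> ?B)"
      "\<And>\<Delta> x. finite \<Delta> \<Longrightarrow> \<Delta> \<subseteq> \<Sigma> \<Longrightarrow> holds C (case_sum x id) (\<chi> \<Delta>) \<longleftrightarrow> E \<Delta> (x ())"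
      by metis
    let ?\<Gamma> = "\<chi> ` {\<Delta>. finite \<Delta> \<and> \<Delta> \<subseteq> \<Sigma>}"
    have "consistent C ?\<Gamma>"
      unfolding consistent_def
    proof (intro allI impI)
      fix D assume "finite D" "D \<subseteq> ?\<Gamma>"
      from finite_subset_image[OF this]
      obtain \<D> where \<D>: "finite \<D>" "\<D> \<subseteq> {\<Delta>. finite \<Delta> \<and> \<Delta> \<subseteq> \<Sigma>}" "D = \<chi> ` \<D>"
        by blast
      then have "finite (\<Union>\<D>)" "\<Union>\<D> \<subseteq> \<Sigma>" by auto
      from okD[OF \<open>ok G\<close> this] obtain e where e: "realizes C e (\<Union>\<D>)" "\<forall>v m. (v, m) \<in> G \<longrightarrow> e v = m"
        by blast
      then have "E \<Delta> (e v)" if "\<Delta> \<in> \<D>" for \<Delta>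
        unfolding E_def using that by (intro exI[of _ e]) (auto simp: realizes_def)
      then have "realizes C (\<lambda>_. e v) D"
        using \<D> \<chi>(2)[of _ "\<lambda>_. e v"] by (auto simp: realizes_def)
      then show "\<exists>a. realizes C a D" by blast
    qed
    moreover have "?\<Gamma> \<subseteq> formulas L (UNIV <+> ?B)" using \<chi>(1) by blast
    moreover have "small ?B"
    proof -
      have "Range G \<subseteq> g ` V" using \<open>ok G\<close> g by (force simp: ok_def image_iff)
      then show ?thesis using V B small_Un small_image small_subset by metis
    qed
    moreover have "saturated L \<mu> C" using monster by (simp add: monster_model_def)
    ultimately obtain x where "realizes C x ?\<Gamma>" unfolding saturated_def by blast
    then have "E \<Delta> (x ())" if "finite \<Delta>" "\<Delta> \<subseteq> \<Sigma>" for \<Delta>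
      using that \<chi>(2)[OF that, of x] by (auto simp: realizes_def)
    then have "\<exists>e. realizes C e \<Delta> \<and> (\<forall>w m. (w, m) \<in> insert (v, x ()) G \<longrightarrow> e w = m)"
      if "finite \<Delta>" "\<Delta> \<subseteq> \<Sigma>" for \<Delta>
      using that unfolding E_def by fastforce
    moreover have "Domain (insert (v, x ()) G) \<subseteq> V"
      using \<open>ok G\<close> v(1) by (auto simp: ok_def)
    ultimately have "ok (insert (v, x ()) G)" by (simp add: ok_def)
    then have "insert (v, x ()) G = G" using max by blast
    then show False using v(2) by blast
  qed
  have "holds C (case_sum g id) \<phi>" if "\<phi> \<in> \<Sigma>" for \<phi>
  proof -
    from okD[OF \<open>ok G\<close>, of "{\<phi>}"] that
    obtain e where e: "realizes C e {\<phi>}" "\<forall>v m. (v, m) \<in> G \<longrightarrow> e v = m" by auto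
    have "e v = g v" if "v \<in> V" for v
      using that \<open>V \<subseteq> Domain G\<close> e(2) g by fastforce
    then have "holds C (case_sum e id) \<phi> \<longleftrightarrow> holds C (case_sum g id) \<phi>"
      using that \<Sigma> by (intro sat_cong) (auto simp: formulas_def split: sum.split)
    then show ?thesis using e(1) by (simp add: realizes_def)
  qed
  then show ?thesis unfolding realizes_def by blast
qed


section \<open>Heirs: moving a configuration from \<open>M\<close> to \<open>A\<close>\<close>

lemma expressible_Ex:
  assumes "expressible L C (U <+> V) R"
  shows "expressible L C V (\<lambda>h. \<exists>e. R (case_sum e h))"
proof -
  \<comment> \<open>The projection leaves no variables on the left, so a default value serves for them.\<close>
  let ?f = "case_sum (\<lambda>_. undefined) id"
  have "?f ` ((U <+> V) \<inter> range Inr) \<subseteq> V" by auto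
  from expressible_rename[OF expressible_project[OF univ_C assms] this]
  have "expressible L C V (\<lambda>h. \<exists>e'. (\<forall>v\<in>range Inr. e' v = (h \<circ> ?f) v) \<and> R e')" .
  moreover have "(\<exists>e'. (\<forall>v\<in>range Inr. e' v = (h \<circ> ?f) v) \<and> R e') \<longleftrightarrow> (\<exists>e. R (case_sum e h))" for h
  proof
    assume "\<exists>e'. (\<forall>v\<in>range Inr. e' v = (h \<circ> ?f) v) \<and> R e'"
    then obtain e' where e': "\<forall>v\<in>range Inr. e' v = (h \<circ> ?f) v" "R e'" by blast
    then have "e' = case_sum (e' \<circ> Inl) h" by (auto simp: fun_eq_iff split: sum.split)
    with e'(2) show "\<exists>e. R (case_sum e h)" by metis
  next
    assume "\<exists>e. R (case_sum e h)"
    then obtain e where "R (case_sum e h)" by blast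
    then show "\<exists>e'. (\<forall>v\<in>range Inr. e' v = (h \<circ> ?f) v) \<and> R e'"
      by (intro exI[of _ "case_sum e h"]) auto
  qed
  ultimately show ?thesis by simp
qed

text \<open>
  The Tarski-Vaught criterion for several variables at once.  The elements of \<open>A\<close> themselves serve
  as variables, so that \<open>h\<close> substitutes elements of \<open>M\<close> for them and keeps those already in \<open>M\<close>.
\<close>

lemma tarski_vaught:
  assumes M: "elementary_submodel L C M" and Q: "expressible L C A Q" "Q id"
  obtains h where "range h \<subseteq> M" "\<And>m. m \<in> M \<Longrightarrow> h m = m" "Q h"
proof -
  have "M \<noteq> {}" using M by (auto simp: elementary_submodel_def is_structure_def)
  then obtain m\<^sub>0 where m\<^sub>0: "m\<^sub>0 \<in> M" by blast
  have elem: "holds (C\<lparr>univ := M\<rparr>) h \<phi> \<longleftrightarrow> holds C h \<phi>"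
    if "\<phi> \<in> formulas L UNIV" "range h \<subseteq> M" for \<phi> h
  proof -
    have "map_fm h \<phi> \<in> formulas L M" using that by (auto simp: map_formulas)
    then have "holds (C\<lparr>univ := M\<rparr>) id (map_fm h \<phi>) \<longleftrightarrow> holds C id (map_fm h \<phi>)"
      using M by (simp add: elementary_submodel_def)
    then show ?thesis by (simp add: sat_map)
  qed
  have *: "\<exists>h. range h \<subseteq> M \<and> (\<forall>m\<in>M. h m = m) \<and> holds C h \<phi>"
    if "finite F" "F \<inter> M = {}" "\<phi> \<in> formulas L (F \<union> M)" "holds C id \<phi>" for F \<phi>
    using that
  proof (induction F arbitrary: \<phi>)
    case empty
    let ?h = "\<lambda>m. if m \<in> M then m else m\<^sub>0"
    have "holds C ?h \<phi> \<longleftrightarrow> holds C id \<phi>"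
      using empty.prems by (intro sat_cong) (auto simp: formulas_def)
    with empty.prems(3) have "holds C ?h \<phi>" by blast
    then show ?case using m\<^sub>0 by (intro exI[of _ ?h]) auto
  next
    case (insert y F)
    let ?\<psi> = "Exists y \<phi>"
    have \<psi>: "?\<psi> \<in> formulas L (F \<union> M)"
      using Exists_formulas[OF insert.prems(2), of y] by (rule formulas_mono) auto
    have "id(y := y) = (id :: 'm \<Rightarrow> 'm)" by (simp add: fun_eq_iff)
    with insert.prems(3) have "holds C (id(y := y)) \<phi>" by (simp only:)
    then have "holds C id ?\<psi>"
      unfolding holds_Exists[OF insert.prems(2)] by (intro bexI[of _ y]) simp_all
    moreover have "F \<inter> M = {}" using insert.prems(1) by blast
    ultimately obtain h where h: "range h \<subseteq> M" "\<forall>m\<in>M. h m = m" "holds C h ?\<psi>"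
      using insert.IH[OF _ \<psi>] by blast
    then have "holds (C\<lparr>univ := M\<rparr>) h ?\<psi>"
      using elem[OF formulas_mono[OF \<psi> subset_UNIV] h(1)] by simp
    then obtain m where m: "m \<in> M" "holds (C\<lparr>univ := M\<rparr>) (h(y := m)) \<phi>"
      unfolding holds_Exists[OF insert.prems(2)] by auto
    then have "holds C (h(y := m)) \<phi>" (is "holds C ?h \<phi>")
      using elem[of \<phi> "h(y := m)"] formulas_mono[OF insert.prems(2)] h(1) by auto
    moreover have "range ?h \<subseteq> M" "\<forall>m\<in>M. ?h m = m" using h m insert.prems(1) by auto
    ultimately show ?case by blast
  qed
  from Q obtain \<phi> where \<phi>: "\<phi> \<in> formulas L A" "\<And>e. holds C e \<phi> \<longleftrightarrow> Q e"
    by (auto simp: expressible_def)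
  then have "\<phi> \<in> formulas L ((fv \<phi> - M) \<union> M)" by (auto simp: formulas_def)
  from *[OF _ _ this] obtain h where "range h \<subseteq> M" "\<forall>m\<in>M. h m = m" "holds C h \<phi>"
    using \<phi> Q(2) finite_fv[of \<phi>] by auto
  then show thesis using that \<phi>(2) by blast
qed

text \<open>
  The properties with parameters in \<open>A\<close> that \<open>e'\<close> must have are those that \<open>e\<close> has whenever the
  parameters are replaced by elements of \<open>M\<close>, those in \<open>M\<close> being kept.  For \<open>M \<subseteq> A\<close> this means
  that \<open>e'\<close> realizes the type of \<open>e\<close> over \<open>M\<close>, and that the type of \<open>A\<close> over \<open>M e'\<close> is finitely
  satisfiable in \<open>M\<close>.
\<close>

definition coheir_copy :: "'m set \<Rightarrow> 'm set \<Rightarrow> 'v set \<Rightarrow> ('v \<Rightarrow> 'm) \<Rightarrow> ('v \<Rightarrow> 'm) \<Rightarrow> bool" where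
  "coheir_copy M A V e e' \<longleftrightarrow> (\<forall>Q. expressible L C (V <+> A) Q \<longrightarrow>
     (\<forall>h. range h \<subseteq> M \<longrightarrow> (\<forall>m\<in>M. h m = m) \<longrightarrow> Q (case_sum e h)) \<longrightarrow> Q (case_sum e' id))"

lemma coheir_copyD:
  assumes "coheir_copy M A V e e'" "expressible L C (V <+> A) Q"
    and "\<And>h. range h \<subseteq> M \<Longrightarrow> (\<And>m. m \<in> M \<Longrightarrow> h m = m) \<Longrightarrow> Q (case_sum e h)"
  shows "Q (case_sum e' id)"
  using assms unfolding coheir_copy_def by blast

text \<open>
  If finitely many of the required properties were not jointly realized for the given parameters in
  \<open>A\<close>, then by the Tarski-Vaught criterion neither would they be for some parameters in \<open>M\<close>,
  although \<open>e\<close> has them all.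
\<close>

lemma coheir_copy_exists:
  fixes V :: "'v set"
  assumes "small V" "small A" and M: "elementary_submodel L C M"
  shows "\<exists>e'. coheir_copy M A V e e'"
proof -
  define \<Sigma> where "\<Sigma> = {\<phi>\<in>formulas L (V <+> A).
      \<forall>h. range h \<subseteq> M \<longrightarrow> (\<forall>m\<in>M. h m = m) \<longrightarrow> holds C (case_sum e h) \<phi>}"
  have "consistent C \<Sigma>"
    unfolding consistent_def
  proof (intro allI impI)
    fix \<Delta> assume \<Delta>: "finite \<Delta>" "\<Delta> \<subseteq> \<Sigma>"
    then have "\<Delta> \<subseteq> formulas L (V <+> A)" by (auto simp: \<Sigma>_def)
    from finite_conjunction[OF \<Delta>(1) this]
    obtain \<theta> where \<theta>: "\<theta> \<in> formulas L (V <+> A)"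
      "\<And>e. holds C e \<theta> \<longleftrightarrow> (\<forall>\<phi>\<in>\<Delta>. holds C e \<phi>)" by blast
    show "\<exists>a. realizes C a \<Delta>"
    proof (rule ccontr)
      assume "\<nexists>a. realizes C a \<Delta>"
      then have "\<not> (\<exists>e. holds C (case_sum e id) \<theta>)" using \<theta>(2) by (auto simp: realizes_def)
      from tarski_vaught[OF M expressible_neg[OF expressible_Ex[OF expressible_holds[OF \<theta>(1)]]] this]
      obtain h where "range h \<subseteq> M" "\<And>m. m \<in> M \<Longrightarrow> h m = m" "\<not> (\<exists>e. holds C (case_sum e h) \<theta>)"
        by blast
      moreover from this \<Delta>(2) have "\<forall>\<phi>\<in>\<Delta>. holds C (case_sum e h) \<phi>" by (auto simp: \<Sigma>_def)
      ultimately show False using \<theta>(2) by blast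
    qed
  qed
  moreover have "\<Sigma> \<subseteq> formulas L (V <+> A)" by (auto simp: \<Sigma>_def)
  ultimately obtain e' where e': "realizes C e' \<Sigma>"
    using small_tuple_saturation[OF assms(1,2)] by blast
  have "Q (case_sum e' id)"
    if Q: "expressible L C (V <+> A) Q"
      and all: "\<forall>h. range h \<subseteq> M \<longrightarrow> (\<forall>m\<in>M. h m = m) \<longrightarrow> Q (case_sum e h)" for Q
  proof -
    from Q obtain \<phi> where \<phi>: "\<phi> \<in> formulas L (V <+> A)" "\<And>e. holds C e \<phi> \<longleftrightarrow> Q e"
      by (auto simp: expressible_def)
    with all have "\<phi> \<in> \<Sigma>" by (simp add: \<Sigma>_def)
    then show ?thesis using e' \<phi>(2) by (auto simp: realizes_def)
  qed
  then show ?thesis unfolding coheir_copy_def by blast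
qed

text \<open>
  For a type \<open>p\<close> over \<open>A\<close> that is definable over \<open>M\<close>, the definition of \<open>p\<close> recognizes the
  substitutions of elements of \<open>M\<close> for those of \<open>A\<close> that keep the formula \<open>\<chi>\<close> in \<open>p\<close>.
\<close>

lemma definable_type_substitution:
  assumes "p \<subseteq> formulas L (X <+> A)" "M \<subseteq> A" "definable_over L C X A p M" "\<chi> \<in> p"
  obtains D where "expressible L C A D" "D id"
    "\<And>h. range h \<subseteq> M \<Longrightarrow> (\<And>m. m \<in> M \<Longrightarrow> h m = m) \<Longrightarrow> D h \<Longrightarrow>
      map_fm (map_sum id h) \<chi> \<in> restrict_type L X p M"
proof -
  have \<chi>: "\<chi> \<in> formulas L (X <+> A)" using assms by blast
  define P where "P = Inr -` fv \<chi>"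
  have "finite P" unfolding P_def by (intro finite_vimageI finite_fv) simp
  have "P \<subseteq> A" using \<chi> by (auto simp: P_def formulas_def)
  from finite_imp_inj_to_nat_seg[OF \<open>finite P\<close>] obtain g :: "'m \<Rightarrow> nat" where g: "inj_on g P" by blast
  define k where "k = inv_into P g"
  have kg: "k (g u) = u" if "u \<in> P" for u using that g by (simp add: k_def)
  let ?Y = "g ` P"
  let ?\<phi> = "map_fm (map_sum id g) \<chi>"
  have fv_\<chi>: "fv \<chi> \<subseteq> X <+> P" using \<chi> by (auto simp: P_def formulas_def)
  have "?\<phi> \<in> formulas L (X <+> ?Y)"
    by (rule map_formulasI[where U = "X <+> P"]) (use \<chi> fv_\<chi> in \<open>auto simp: formulas_def\<close>)
  from assms(3)[unfolded definable_over_def, rule_format, OF finite_imageI[OF \<open>finite P\<close>] this]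
  obtain \<psi> where \<psi>: "\<psi> \<in> formulas L (?Y <+> M)"
    "\<And>b. b ` ?Y \<subseteq> A \<Longrightarrow> inst_right b ?\<phi> \<in> p \<longleftrightarrow> holds C (case_sum b id) \<psi>"
    by blast
  have inst: "inst_right (h \<circ> k) ?\<phi> = map_fm (map_sum id h) \<chi>" for h
    unfolding inst_right_def fm.map_comp
  proof (rule fm.map_cong0)
    fix v assume "v \<in> fv \<chi>"
    with fv_\<chi> have "v \<in> X <+> P" by blast
    then show "(map_sum id (h \<circ> k) \<circ> map_sum id g) v = map_sum id h v" by (auto simp: kg)
  qed
  define D where "D = (\<lambda>h. holds C (h \<circ> case_sum k id) \<psi>)"
  have "case_sum k id ` (?Y <+> M) \<subseteq> A" using \<open>P \<subseteq> A\<close> assms(2) by (auto simp: kg)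
  from expressible_rename[OF expressible_holds[OF \<psi>(1)] this]
  have "expressible L C A D" by (simp add: D_def)
  moreover have "D id"
  proof -
    have "inst_right k ?\<phi> = \<chi>" using inst[of id] by (simp add: sum.map_id0 fm.map_id)
    moreover have "k ` ?Y \<subseteq> A" using \<open>P \<subseteq> A\<close> by (auto simp: kg)
    ultimately show ?thesis using \<psi>(2)[of k] assms(4) by (simp add: D_def)
  qed
  moreover have "map_fm (map_sum id h) \<chi> \<in> restrict_type L X p M"
    if h: "range h \<subseteq> M" "\<And>m. m \<in> M \<Longrightarrow> h m = m" "D h" for h
  proof -
    have "holds C (case_sum (h \<circ> k) id) \<psi> \<longleftrightarrow> holds C (h \<circ> case_sum k id) \<psi>"
      using \<psi>(1) h(2) by (intro sat_cong) (auto simp: formulas_def)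
    then have "inst_right (h \<circ> k) ?\<phi> \<in> p" using \<psi>(2)[of "h \<circ> k"] h assms(2) by (auto simp: D_def)
    moreover have "map_fm (map_sum id h) \<chi> \<in> formulas L (X <+> M)"
      using h(1) by (intro map_formulasI[OF \<chi>]) (auto simp: image_subset_iff)
    ultimately show ?thesis using inst[of h] by (simp add: restrict_type_def)
  qed
  ultimately show thesis using that by blast
qed

text \<open>
  For \<open>\<chi> \<in> p\<close>, the implication from the definition of \<open>\<chi> \<in> p\<close> to \<open>\<chi>\<close> holds of a realization of
  \<open>p\<restriction>M\<close> for all parameters in \<open>M\<close>; hence it holds of the copy for the given ones, for which the
  premise is true.
\<close>

lemma coheir_copy_realizes:
  assumes p: "p \<subseteq> formulas L (X <+> A)" "M \<subseteq> A" "definable_over L C X A p M"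
    and e': "coheir_copy M A V e e'" and f: "f ` X \<subseteq> V"
    and e: "realizes C (e \<circ> f) (restrict_type L X p M)"
  shows "realizes C (e' \<circ> f) p"
  unfolding realizes_def
proof
  fix \<chi> assume "\<chi> \<in> p"
  from definable_type_substitution[OF p this] obtain D where D: "expressible L C A D" "D id"
    "\<And>h. range h \<subseteq> M \<Longrightarrow> (\<And>m. m \<in> M \<Longrightarrow> h m = m) \<Longrightarrow> D h \<Longrightarrow>
      map_fm (map_sum id h) \<chi> \<in> restrict_type L X p M" by blast
  define Q where "Q \<epsilon> \<longleftrightarrow> D (\<epsilon> \<circ> Inr) \<longrightarrow> holds C (\<epsilon> \<circ> map_sum f id) \<chi>" for \<epsilon>
  have "\<chi> \<in> formulas L (X <+> A)" using \<open>\<chi> \<in> p\<close> p(1) by blast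
  then have "expressible L C (V <+> A) Q"
    unfolding Q_def using f
    by (intro expressible_imp expressible_rename[OF D(1)] expressible_rename[OF expressible_holds])
      auto
  moreover have "Q (case_sum e h)" if h: "range h \<subseteq> M" "\<And>m. m \<in> M \<Longrightarrow> h m = m" for h
    unfolding Q_def
  proof
    assume "D (case_sum e h \<circ> Inr)"
    then have "map_fm (map_sum id h) \<chi> \<in> restrict_type L X p M"
      using D(3) h by (simp add: case_sum_o_inj)
    with e have "holds C (case_sum (e \<circ> f) id \<circ> map_sum id h) \<chi>"
      by (auto simp: realizes_def sat_map)
    moreover have "case_sum (e \<circ> f) id \<circ> map_sum id h = case_sum e h \<circ> map_sum f id"
    proof
      show "(case_sum (e \<circ> f) id \<circ> map_sum id h) v = (case_sum e h \<circ> map_sum f id) v" for v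
        by (cases v) auto
    qed
    ultimately show "holds C (case_sum e h \<circ> map_sum f id) \<chi>" by simp
  qed
  ultimately have "Q (case_sum e' id)" using coheir_copyD[OF e'] by blast
  then have "holds C (case_sum e' id \<circ> map_sum f id) \<chi>" using D(2) by (simp add: Q_def case_sum_o_inj)
  moreover have "case_sum e' id \<circ> map_sum f id = case_sum (e' \<circ> f) id"
  proof
    show "(case_sum e' id \<circ> map_sum f id) v = case_sum (e' \<circ> f) id v" for v
      by (cases v) auto
  qed
  ultimately show "holds C (case_sum (e' \<circ> f) id) \<chi>" by simp
qed


section \<open>The independence property\<close>

text \<open>
  The pattern of consistency that the \<open>a\<^sub>i\<close> show is a property without parameters of the sequence,
  so it is inherited by a coheir copy.
\<close>

lemma IP_definable_extension:
  fixes X :: "'x set"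
  assumes p: "p \<subseteq> formulas L (X <+> A)" "M \<subseteq> A" "definable_over L C X A p M"
    and "small X" "small A" "elementary_submodel L C M"
    and IP: "IP L C X (restrict_type L X p M)"
  shows "IP L C X p"
proof -
  from IP obtain Y :: "nat set" and \<phi> a where Y: "finite Y" and \<phi>: "\<phi> \<in> formulas L (X <+> Y)"
    and a: "\<And>i. realizes C (a i) (restrict_type L X p M)"
    and indep: "\<And>s :: nat set.
      consistent C {if i \<in> s then inst_left (a i) \<phi> else Neg (inst_left (a i) \<phi>) |i. True}"
    unfolding IP_def by blast
  define V where "V = (UNIV :: nat set) \<times> X"
  define e where "e = (\<lambda>(i, x). a i x)"
  have "small V" unfolding V_def by (intro small_Times small_nat \<open>small X\<close>)
  then obtain e' where e': "coheir_copy M A V e e'"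
    using coheir_copy_exists assms(5,6) by blast
  define a' where "a' i = e' \<circ> Pair i" for i
  have inst: "holds C (case_sum y id) (if i \<in> s then inst_left (c \<circ> Pair i) \<phi> else Neg (inst_left (c \<circ> Pair i) \<phi>)) \<longleftrightarrow>
      (holds C (case_sum y c \<circ> case_sum (Inr \<circ> Pair i) Inl) \<phi> \<longleftrightarrow> i \<in> s)" for i :: nat and s y c
  proof -
    have "case_sum y id \<circ> case_sum (Inr \<circ> (c \<circ> Pair i)) Inl = case_sum y c \<circ> case_sum (Inr \<circ> Pair i) Inl"
      by (auto simp: fun_eq_iff split: sum.split)
    then show ?thesis by (simp add: inst_left_def sat_map)
  qed
  have "realizes C (a' i) p" for i
  proof -
    have "e \<circ> Pair i = a i" by (simp add: e_def fun_eq_iff)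
    then show ?thesis
      unfolding a'_def using a[of i] by (intro coheir_copy_realizes[OF p e']) (auto simp: V_def)
  qed
  moreover have "consistent C {if i \<in> s then inst_left (a' i) \<phi> else Neg (inst_left (a' i) \<phi>) |i. True}"
    for s :: "nat set"
    unfolding consistent_def
  proof (intro allI impI)
    let ?F = "\<lambda>a i. if i \<in> s then inst_left (a i) \<phi> else Neg (inst_left (a i) \<phi>)"
    fix \<Delta> assume "finite \<Delta>" and \<Delta>: "\<Delta> \<subseteq> {?F a' i |i. True}"
    then have "\<Delta> \<subseteq> ?F a' ` UNIV" by blast
    from finite_subset_image[OF \<open>finite \<Delta>\<close> this] obtain J where J: "finite J" "\<Delta> = ?F a' ` J" by blast
    define R where "R \<epsilon> \<longleftrightarrow> (\<forall>i\<in>J. holds C (\<epsilon> \<circ> case_sum (Inr \<circ> Pair i) Inl) \<phi> \<longleftrightarrow> i \<in> s)" for \<epsilon>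
    have "expressible L C (Y <+> V) R"
      unfolding R_def
      by (intro expressible_finite_ball J(1) expressible_iff expressible_const
          expressible_rename[OF expressible_holds[OF \<phi>]]) (auto simp: V_def)
    from expressible_rename[OF expressible_Ex[OF this], of Inl "V <+> A"]
    have "expressible L C (V <+> A) (\<lambda>\<epsilon>. \<exists>y. R (case_sum y (\<epsilon> \<circ> Inl)))" by auto
    moreover have "\<exists>y. R (case_sum y (case_sum e h \<circ> Inl))" for h
    proof -
      have "finite (?F a ` J)" "?F a ` J \<subseteq> {?F a i |i. True}" using J(1) by auto
      then obtain y where y: "realizes C y (?F a ` J)"
        using indep[of s] unfolding consistent_def by blast
      have ea: "e \<circ> Pair i = a i" for i by (simp add: e_def fun_eq_iff)
      have "R (case_sum y e)"
        unfolding R_def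
      proof
        fix i assume "i \<in> J"
        with y have "holds C (case_sum y id) (?F a i)" by (auto simp: realizes_def)
        then show "holds C (case_sum y e \<circ> case_sum (Inr \<circ> Pair i) Inl) \<phi> \<longleftrightarrow> i \<in> s"
          using inst[of y i s e] by (simp only: ea)
      qed
      then show ?thesis by (auto simp: case_sum_o_inj)
    qed
    ultimately have "\<exists>y. R (case_sum y (case_sum e' id \<circ> Inl))"
      using coheir_copyD[OF e', of "\<lambda>\<epsilon>. \<exists>y. R (case_sum y (\<epsilon> \<circ> Inl))"] by blast
    then obtain y where "R (case_sum y e')" by (auto simp: case_sum_o_inj)
    then have "holds C (case_sum y id) (?F a' i)" if "i \<in> J" for i
      using inst[of y i s e'] that by (simp only: R_def a'_def)
    then have "realizes C y (?F a' ` J)" unfolding realizes_def by blast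
    with J(2) show "\<exists>y. realizes C y \<Delta>" by blast
  qed
  ultimately show ?thesis
    unfolding IP_def using Y \<phi> by blast
qed


section \<open>The dp-rank\<close>

abbreviation seq_env :: "('k, 'm) tuple_seq \<Rightarrow> (nat \<Rightarrow> 'k) \<Rightarrow> (nat \<times> 'k) + 'm \<Rightarrow> 'm" where
  "seq_env s i \<equiv> case_sum (\<lambda>(k, j). entry s (i k) j) id"

lemma not_indiscernibleE:
  assumes "\<not> indiscernible L C B s"
  obtains n i i' \<phi> where "increasing s n i" "increasing s n i'"
    "\<phi> \<in> formulas L (({..<n} \<times> coords s) <+> B)"
    "holds C (seq_env s i) \<phi>" "\<not> holds C (seq_env s i') \<phi>"
  using assms unfolding indiscernible_def by metis

lemma indiscernibleD:
  assumes "indiscernible L C B s" "increasing s n i" "increasing s n i'"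
    "\<phi> \<in> formulas L (({..<n} \<times> coords s) <+> B)"
  shows "holds C (seq_env s i) \<phi> \<longleftrightarrow> holds C (seq_env s i') \<phi>"
  using assms unfolding indiscernible_def by blast

lemma indiscernible_mono:
  fixes s :: "('k, 'm) tuple_seq"
  assumes "indiscernible L C B s" "B' \<subseteq> B"
  shows "indiscernible L C B' s"
  unfolding indiscernible_def
proof (intro allI impI ballI)
  fix n i i' \<phi>
  assume i: "increasing s n i" "increasing s n i'"
    and "\<phi> \<in> formulas L (({..<n} \<times> coords s) <+> B')"
  then have "\<phi> \<in> formulas L (({..<n} \<times> coords s) <+> B)"
    using assms(2) by (elim formulas_mono) auto
  with i show "holds C (seq_env s i) \<phi> \<longleftrightarrow> holds C (seq_env s i') \<phi>"
    by (rule indiscernibleD[OF assms(1)])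
qed

lemma mutually_indiscernible_transfer:
  fixes I I' :: "'i \<Rightarrow> ('k, 'm) tuple_seq"
  assumes "mutually_indiscernible L C A K I"
    and "\<And>\<alpha> A'. \<alpha> \<in> K \<Longrightarrow> A \<subseteq> A' \<Longrightarrow> indiscernible L C A' (I \<alpha>) \<Longrightarrow> indiscernible L C A' (I' \<alpha>)"
    and "\<And>\<alpha>. \<alpha> \<in> K \<Longrightarrow> elems (I' \<alpha>) \<subseteq> elems (I \<alpha>) \<union> A" and "M \<subseteq> A"
  shows "mutually_indiscernible L C M K I'"
  unfolding mutually_indiscernible_def
proof
  fix \<alpha> assume \<alpha>: "\<alpha> \<in> K"
  let ?A = "A \<union> (\<Union>\<beta>\<in>K - {\<alpha>}. elems (I \<beta>))"
  have "indiscernible L C ?A (I' \<alpha>)"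
    using assms(1) \<alpha> by (intro assms(2)) (auto simp: mutually_indiscernible_def)
  moreover have "M \<union> (\<Union>\<beta>\<in>K - {\<alpha>}. elems (I' \<beta>)) \<subseteq> ?A" using assms(3,4) by blast
  ultimately show "indiscernible L C (M \<union> (\<Union>\<beta>\<in>K - {\<alpha>}. elems (I' \<beta>))) (I' \<alpha>)"
    by (rule indiscernible_mono)
qed

text \<open>
  The finitely many parameters from \<open>A\<close> in a formula that witnesses the failure of
  indiscernibility can be appended, as constant coordinates, to the tuples of the sequence.
\<close>

lemma absorb_parameters:
  assumes s: "infinite_sequence \<mu> s" and "\<not> indiscernible L C (B \<union> A) s"
  obtains s' where "infinite_sequence \<mu> s'" "\<not> indiscernible L C B s'" "elems s' \<subseteq> elems s \<union> A"
    "\<And>A'. A \<subseteq> A' \<Longrightarrow> indiscernible L C A' s \<Longrightarrow> indiscernible L C A' s'"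
proof -
  from assms(2) obtain n i i' \<phi> where i: "increasing s n i" "increasing s n i'"
    and \<phi>: "\<phi> \<in> formulas L (({..<n} \<times> coords s) <+> (B \<union> A))"
    "holds C (seq_env s i) \<phi>" "\<not> holds C (seq_env s i') \<phi>"
    by (rule not_indiscernibleE)
  define J where "J = snd ` (Inl -` fv \<phi>)"
  define P where "P = A \<inter> Inr -` fv \<phi>"
  have fin: "finite J" "finite P"
    unfolding J_def P_def by (simp_all add: finite_vimageI finite_fv)
  have fv: "fv \<phi> \<subseteq> ({..<n} \<times> coords s) <+> (B \<union> A)" using \<phi>(1) by (simp add: formulas_def)
  have J: "j \<in> J" if "Inl (k, j) \<in> fv \<phi>" for k j
    using that by (force simp: J_def)
  have "J \<subseteq> coords s"
  proof
    fix j assume "j \<in> J"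
    then obtain k where "Inl (k, j) \<in> fv \<phi>" by (auto simp: J_def)
    with fv show "j \<in> coords s" by blast
  qed
  have "P \<subseteq> A" by (simp add: P_def)
  have P: "u \<in> P" if "Inr u \<in> fv \<phi>" "u \<in> A" for u
    using that by (simp add: P_def)
  have "infinite (UNIV :: 'k set)" using infinite_Field_\<mu> infinite_super[OF subset_UNIV] by blast
  from infinite_arbitrarily_large[OF this, of "card (J <+> P)"]
  obtain Z :: "'k set" where Z: "finite Z" "card Z = card (J <+> P)" by blast
  from finite_same_card_bij[OF Z(1) finite_Plus[OF fin] Z(2)]
  obtain r where r: "bij_betw r Z (J <+> P)" by blast
  define q where "q = inv_into Z r"
  have q: "q v \<in> Z" "r (q v) = v" if "v \<in> J <+> P" for v
    using that inv_into_into[of v r Z] f_inv_into_f[of v r Z] unfolding q_def bij_betw_imp_surj_on[OF r]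
    by blast+
  have rZ: "r c \<in> J <+> P" if "c \<in> Z" for c
    using bij_betw_apply[OF r that] .
  \<comment> \<open>Keeping only the finitely many coordinates that occur in \<open>\<phi>\<close> makes room for the constants.\<close>
  define s' where "s' = s\<lparr>coords := Z, entry := \<lambda>l c. case_sum (entry s l) id (r c)\<rparr>"
  have incr: "increasing s' = increasing s" by (intro ext) (simp add: increasing_def s'_def)
  have "infinite_sequence \<mu> s'"
    using s small_finite[OF Z(1)] by (simp add: infinite_sequence_def s'_def)
  moreover have "elems s' \<subseteq> elems s \<union> A"
  proof
    fix u assume "u \<in> elems s'"
    then obtain l c where "l \<in> points s" "c \<in> Z" and u: "u = case_sum (entry s l) id (r c)"
      by (auto simp: elems_def s'_def)
    from rZ[OF \<open>c \<in> Z\<close>] consider j where "r c = Inl j" "j \<in> J" | w where "r c = Inr w" "w \<in> P"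
      by blast
    then show "u \<in> elems s \<union> A"
    proof cases
      case 1
      with u have "u = entry s l j" by simp
      then show ?thesis using 1 \<open>l \<in> points s\<close> \<open>J \<subseteq> coords s\<close> unfolding elems_def by blast
    qed (use u \<open>P \<subseteq> A\<close> in auto)
  qed
  moreover have "\<not> indiscernible L C B s'"
  proof
    assume ind: "indiscernible L C B s'"
    \<comment> \<open>The constants are read off from the tuple with number \<open>0\<close>, which thus has to exist.\<close>
    have "n \<noteq> 0"
    proof
      assume "n = 0"
      then have "holds C (seq_env s i) \<phi> \<longleftrightarrow> holds C (seq_env s i') \<phi>"
        using \<phi>(1) by (intro sat_cong) (auto simp: formulas_def)
      with \<phi> show False by blast
    qed
    define \<rho> :: "(nat \<times> 'k) + 'm \<Rightarrow> (nat \<times> 'k) + 'm" where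
      "\<rho> = case_sum (\<lambda>(k, j). Inl (k, q (Inl j)))
        (\<lambda>u. if u \<in> P then Inl (0, q (Inr u)) else Inr u)"
    have "map_fm \<rho> \<phi> \<in> formulas L (({..<n} \<times> coords s') <+> B)"
    proof (rule map_formulasI)
      show "\<phi> \<in> formulas L (fv \<phi>)" using \<phi>(1) by (simp add: formulas_def)
      show "\<rho> ` fv \<phi> \<subseteq> ({..<n} \<times> coords s') <+> B"
      proof (rule image_subsetI)
        fix v assume v: "v \<in> fv \<phi>"
        with fv have "v \<in> ({..<n} \<times> coords s) <+> (B \<union> A)" by blast
        with v show "\<rho> v \<in> ({..<n} \<times> coords s') <+> B"
          using \<open>n \<noteq> 0\<close> J P q(1)[OF InlI] q(1)[OF InrI] by (cases v rule: sum.exhaust) (auto simp: \<rho>_def s'_def)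
      qed
    qed
    from indiscernibleD[OF ind i[folded incr] this]
    have "holds C (seq_env s' i \<circ> \<rho>) \<phi> \<longleftrightarrow> holds C (seq_env s' i' \<circ> \<rho>) \<phi>"
      unfolding sat_map .
    moreover have "holds C (seq_env s' i \<circ> \<rho>) \<phi> \<longleftrightarrow> holds C (seq_env s i) \<phi>" for i
    proof (rule sat_cong)
      fix v assume "v \<in> fv \<phi>"
      then show "(seq_env s' i \<circ> \<rho>) v = seq_env s i v"
        using J P q(2)[OF InlI] q(2)[OF InrI] by (cases v rule: sum.exhaust) (auto simp: \<rho>_def s'_def)
    qed
    ultimately show False using \<phi> by blast
  qed
  moreover have "indiscernible L C A' s'" if A': "A \<subseteq> A'" and ind: "indiscernible L C A' s" for A'
    unfolding indiscernible_def
  proof (intro allI impI ballI)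
    fix n i i' \<chi>
    assume i: "increasing s' n i" "increasing s' n i'"
      and \<chi>: "\<chi> \<in> formulas L (({..<n} \<times> coords s') <+> A')"
    define \<rho> :: "(nat \<times> 'k) + 'm \<Rightarrow> (nat \<times> 'k) + 'm" where
      "\<rho> = case_sum (\<lambda>(k, c). case_sum (\<lambda>j. Inl (k, j)) Inr (r c)) Inr"
    have "\<rho> ` (({..<n} \<times> coords s') <+> A') \<subseteq> ({..<n} \<times> coords s) <+> A'"
    proof (rule image_subsetI)
      fix v assume "v \<in> ({..<n} \<times> coords s') <+> A'"
      then consider k c where "v = Inl (k, c)" "k < n" "c \<in> Z" | u where "v = Inr u" "u \<in> A'"
        by (auto simp: s'_def)
      then show "\<rho> v \<in> ({..<n} \<times> coords s) <+> A'"
      proof cases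
        case 1
        have "P \<subseteq> A'" using \<open>P \<subseteq> A\<close> A' by blast
        with rZ[OF 1(3)] \<open>J \<subseteq> coords s\<close> have "r c \<in> coords s <+> A'" by auto
        then show ?thesis using 1 by (auto simp: \<rho>_def)
      qed (auto simp: \<rho>_def)
    qed
    from indiscernibleD[OF ind i[unfolded incr] map_formulasI[OF \<chi> this]]
    have "holds C (seq_env s i \<circ> \<rho>) \<chi> \<longleftrightarrow> holds C (seq_env s i' \<circ> \<rho>) \<chi>"
      unfolding sat_map .
    moreover have "seq_env s i \<circ> \<rho> = seq_env s' i" for i
    proof
      show "(seq_env s i \<circ> \<rho>) v = seq_env s' i v" for v
        by (auto simp: \<rho>_def s'_def split: sum.split)
    qed
    ultimately show "holds C (seq_env s' i) \<chi> \<longleftrightarrow> holds C (seq_env s' i') \<chi>" by simp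
  qed
  ultimately show thesis using that by blast
qed

lemma dpr_less_extension:
  fixes X :: "'x set"
  assumes "M \<subseteq> A" and "dpr_less L C \<mu> X M (restrict_type L X p M) \<kappa>"
  shows "dpr_less L C \<mu> X A p \<kappa>"
  unfolding dpr_less_def
proof (intro allI impI, rule ccontr)
  fix I b
  assume I: "\<forall>\<alpha>\<in>Field \<kappa>. infinite_sequence \<mu> (I \<alpha>)" "mutually_indiscernible L C A (Field \<kappa>) I"
    and b: "realizes C b p"
    and "\<not> (\<exists>\<beta>\<in>Field \<kappa>. indiscernible L C (b ` X \<union> A) (I \<beta>))"
  then have "\<forall>\<beta>\<in>Field \<kappa>. \<exists>s'. infinite_sequence \<mu> s' \<and> \<not> indiscernible L C (b ` X) s' \<and>
      elems s' \<subseteq> elems (I \<beta>) \<union> A \<and>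
      (\<forall>A'. A \<subseteq> A' \<longrightarrow> indiscernible L C A' (I \<beta>) \<longrightarrow> indiscernible L C A' s')"
    by (metis absorb_parameters)
  from bchoice[OF this] obtain I' where I': "\<And>\<beta>. \<beta> \<in> Field \<kappa> \<Longrightarrow> infinite_sequence \<mu> (I' \<beta>)"
    "\<And>\<beta>. \<beta> \<in> Field \<kappa> \<Longrightarrow> \<not> indiscernible L C (b ` X) (I' \<beta>)"
    "\<And>\<beta>. \<beta> \<in> Field \<kappa> \<Longrightarrow> elems (I' \<beta>) \<subseteq> elems (I \<beta>) \<union> A"
    "\<And>\<beta> A'. \<beta> \<in> Field \<kappa> \<Longrightarrow> A \<subseteq> A' \<Longrightarrow> indiscernible L C A' (I \<beta>) \<Longrightarrow> indiscernible L C A' (I' \<beta>)"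
    by blast
  have "mutually_indiscernible L C M (Field \<kappa>) I'"
    using I(2) I'(4,3) assms(1) by (rule mutually_indiscernible_transfer)
  moreover have "realizes C b (restrict_type L X p M)"
    using b by (simp add: realizes_def restrict_type_def)
  ultimately obtain \<beta> where "\<beta> \<in> Field \<kappa>" "indiscernible L C (b ` X \<union> M) (I' \<beta>)"
    using assms(2) I'(1) unfolding dpr_less_def by blast
  then show False using I'(2) indiscernible_mono by blast
qed

lemma finite_ordLeq_nat:
  assumes "finite S"
  shows "|S| \<le>o |UNIV :: nat set|"
proof -
  have "|S| <o natLeq" using assms by (simp add: finite_iff_ordLess_natLeq)
  then show ?thesis
    using ordLess_ordIso_trans[OF _ ordIso_symmetric[OF card_of_nat]] ordLess_imp_ordLeq by blast
qed

text \<open>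
  A sequence of which only the failure of indiscernibility over \<open>B\<close> matters can be thinned out to
  countably many points and finitely many coordinates.  So even when \<open>\<mu>\<close> is singular, small families
  of sequences can be arranged to have only a small number of entries altogether.
\<close>

lemma thin_subsequence:
  assumes s: "infinite_sequence \<mu> s" and "\<not> indiscernible L C B s"
  obtains s' where "infinite_sequence \<mu> s'" "|points s'| \<le>o |UNIV :: nat set|" "finite (coords s')"
    "\<not> indiscernible L C B s'" "elems s' \<subseteq> elems s"
    "\<And>A'. indiscernible L C A' s \<Longrightarrow> indiscernible L C A' s'"
proof -
  from assms(2) obtain n i i' \<phi> where i: "increasing s n i" "increasing s n i'"
    and \<phi>: "\<phi> \<in> formulas L (({..<n} \<times> coords s) <+> B)"
    "holds C (seq_env s i) \<phi>" "\<not> holds C (seq_env s i') \<phi>"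
    by (rule not_indiscernibleE)
  have fv: "fv \<phi> \<subseteq> ({..<n} \<times> coords s) <+> B" using \<phi>(1) by (simp add: formulas_def)
  define J where "J = snd ` (Inl -` fv \<phi>)"
  have "finite J" unfolding J_def by (simp add: finite_vimageI finite_fv)
  have J: "j \<in> J" if "Inl (k, j) \<in> fv \<phi>" for k j
    using that by (force simp: J_def)
  have "J \<subseteq> coords s"
  proof
    fix j assume "j \<in> J"
    then obtain k where "Inl (k, j) \<in> fv \<phi>" by (auto simp: J_def)
    with fv show "j \<in> coords s" by blast
  qed
  have "infinite (points s)" using s by (simp add: infinite_sequence_def)
  then obtain f :: "nat \<Rightarrow> 'k" where f: "inj f" "range f \<subseteq> points s"
    using infinite_countable_subset by blast
  define S where "S = range f \<union> (i ` {..<n} \<union> i' ` {..<n})"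
  have "S \<subseteq> points s" using f(2) i by (auto simp: S_def increasing_def)
  have inf_nat: "infinite (UNIV :: nat set)" by simp
  have "|S| \<le>o |UNIV :: nat set|"
    unfolding S_def
    by (intro card_of_Un_ordLeq_infinite_Field card_of_image card_of_Card_order finite_ordLeq_nat)
      (simp_all add: Field_card_of)
  have "infinite (range f)" using f(1) by (simp add: finite_image_iff)
  then have "infinite S" by (simp add: S_def)
  define s' where "s' = s\<lparr>points := S, coords := J\<rparr>"
  have incr: "increasing s m l" if "increasing s' m l" for m l
    using that \<open>S \<subseteq> points s\<close> by (auto simp: increasing_def s'_def)
  have env: "seq_env s' l = seq_env s l" for l by (simp add: s'_def)
  have "infinite_sequence \<mu> s'"
  proof -
    have "total_on S (less s)"
      using s \<open>S \<subseteq> points s\<close> unfolding infinite_sequence_def strict_linear_order_on_def total_on_def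
      by blast
    then show ?thesis
      using s \<open>infinite S\<close> small_subset[OF _ \<open>S \<subseteq> points s\<close>] small_finite[OF \<open>finite J\<close>]
      by (simp add: infinite_sequence_def strict_linear_order_on_def s'_def)
  qed
  moreover have "\<not> indiscernible L C B s'"
  proof
    assume ind: "indiscernible L C B s'"
    have "increasing s' n i" "increasing s' n i'"
      using i by (auto simp: increasing_def s'_def S_def)
    moreover have "\<phi> \<in> formulas L (({..<n} \<times> coords s') <+> B)"
    proof -
      have "fv \<phi> \<subseteq> ({..<n} \<times> J) <+> B"
      proof
        fix v assume v: "v \<in> fv \<phi>"
        with fv have "v \<in> ({..<n} \<times> coords s) <+> B" by blast
        then show "v \<in> ({..<n} \<times> J) <+> B" using v J by auto
      qed
      then show ?thesis using \<phi>(1) by (simp add: formulas_def s'_def)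
    qed
    ultimately show False using indiscernibleD[OF ind] \<phi>(2,3) env by metis
  qed
  moreover have "elems s' \<subseteq> elems s"
    using \<open>S \<subseteq> points s\<close> \<open>J \<subseteq> coords s\<close> unfolding elems_def s'_def by fastforce
  moreover have "indiscernible L C A' s'" if ind: "indiscernible L C A' s" for A'
    unfolding indiscernible_def
  proof (intro allI impI ballI)
    fix n i i' \<chi>
    assume i: "increasing s' n i" "increasing s' n i'"
      and \<chi>: "\<chi> \<in> formulas L (({..<n} \<times> coords s') <+> A')"
    have "\<chi> \<in> formulas L (({..<n} \<times> coords s) <+> A')"
      using \<open>J \<subseteq> coords s\<close> by (intro formulas_mono[OF \<chi>]) (auto simp: s'_def)
    from indiscernibleD[OF ind incr[OF i(1)] incr[OF i(2)] this]
    show "holds C (seq_env s' i) \<chi> \<longleftrightarrow> holds C (seq_env s' i') \<chi>" by (simp only: env)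
  qed
  moreover have "finite (coords s')" "|points s'| \<le>o |UNIV :: nat set|"
    using \<open>finite J\<close> \<open>|S| \<le>o |UNIV :: nat set|\<close> by (simp_all add: s'_def)
  ultimately show thesis using that by blast
qed

lemma map_sum_id_image:
  "(\<And>u. u \<in> P \<Longrightarrow> f u \<in> P') \<Longrightarrow> map_sum id f ` (U <+> P) \<subseteq> U <+> P'"
  by auto

lemma small_family:
  assumes "small K" "\<And>\<beta>. \<beta> \<in> K \<Longrightarrow> |P \<beta>| \<le>o |UNIV :: nat set|" "\<And>\<beta>. \<beta> \<in> K \<Longrightarrow> finite (J \<beta>)"
  shows "small (SIGMA \<beta>:K. P \<beta> \<times> J \<beta>)"
proof -
  let ?Z = "K <+> (UNIV :: nat set)"
  have Z: "infinite ?Z" by (simp add: finite_Plus_iff)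
  have FZ: "infinite (Field |?Z| )" unfolding Field_card_of by (rule Z)
  have nat: "|UNIV :: nat set| \<le>o |?Z|" by (rule card_of_Plus2)
  have "|P \<beta> \<times> J \<beta>| \<le>o |?Z|" if "\<beta> \<in> K" for \<beta>
  proof (rule card_of_Times_ordLeq_infinite_Field[OF FZ _ _ card_of_Card_order])
    show "|P \<beta>| \<le>o |?Z|" using assms(2)[OF that] nat by (rule ordLeq_transitive)
    show "|J \<beta>| \<le>o |?Z|"
      using finite_ordLeq_nat[OF assms(3)[OF that]] nat by (rule ordLeq_transitive)
  qed
  then have "|SIGMA \<beta>:K. P \<beta> \<times> J \<beta>| \<le>o |?Z|"
    by (intro card_of_Sigma_ordLeq_infinite[OF Z card_of_Plus1]) blast
  then show ?thesis using small_Plus[OF assms(1) small_nat] by (rule ordLeq_ordLess_trans)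
qed

text \<open>
  A counterexample to \<open>dpr(p\<restriction>M) < \<kappa>\<close>, namely a realization of \<open>p\<restriction>M\<close> together with the entries of
  \<open>\<kappa>\<close> sequences, is replaced by a coheir copy.  The copy realizes \<open>p\<close>, still violates
  indiscernibility over \<open>M\<close>, and consists of sequences that are mutually indiscernible over \<open>A\<close>:
  an instance of indiscernibility with parameters in \<open>A\<close> holds of the original sequences for all
  parameters in \<open>M\<close> instead.
\<close>

lemma dpr_less_restrict:
  fixes X :: "'x set" and \<kappa> :: "'k rel"
  assumes p: "p \<subseteq> formulas L (X <+> A)" "M \<subseteq> A" "definable_over L C X A p M"
    and "small X" "small A" "elementary_submodel L C M"
    and \<kappa>: "Card_order \<kappa>" "\<kappa> <o \<mu>" and dpr: "dpr_less L C \<mu> X A p \<kappa>"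
  shows "dpr_less L C \<mu> X M (restrict_type L X p M) \<kappa>"
  unfolding dpr_less_def
proof (intro allI impI, rule ccontr)
  fix I0 b
  assume I0: "\<forall>\<alpha>\<in>Field \<kappa>. infinite_sequence \<mu> (I0 \<alpha>)" "mutually_indiscernible L C M (Field \<kappa>) I0"
    and b: "realizes C b (restrict_type L X p M)"
    and "\<not> (\<exists>\<beta>\<in>Field \<kappa>. indiscernible L C (b ` X \<union> M) (I0 \<beta>))"
  then have "\<forall>\<beta>\<in>Field \<kappa>. \<exists>s'. infinite_sequence \<mu> s' \<and> |points s'| \<le>o |UNIV :: nat set| \<and>
      finite (coords s') \<and> \<not> indiscernible L C (b ` X \<union> M) s' \<and> elems s' \<subseteq> elems (I0 \<beta>) \<and>
      (\<forall>A'. indiscernible L C A' (I0 \<beta>) \<longrightarrow> indiscernible L C A' s')"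
    by (metis thin_subsequence)
  from bchoice[OF this] obtain I where I: "\<And>\<beta>. \<beta> \<in> Field \<kappa> \<Longrightarrow> infinite_sequence \<mu> (I \<beta>)"
    "\<And>\<beta>. \<beta> \<in> Field \<kappa> \<Longrightarrow> |points (I \<beta>)| \<le>o |UNIV :: nat set|"
    "\<And>\<beta>. \<beta> \<in> Field \<kappa> \<Longrightarrow> finite (coords (I \<beta>))"
    "\<And>\<beta>. \<beta> \<in> Field \<kappa> \<Longrightarrow> \<not> indiscernible L C (b ` X \<union> M) (I \<beta>)"
    "\<And>\<beta>. \<beta> \<in> Field \<kappa> \<Longrightarrow> elems (I \<beta>) \<subseteq> elems (I0 \<beta>)"
    "\<And>\<beta> A'. \<beta> \<in> Field \<kappa> \<Longrightarrow> indiscernible L C A' (I0 \<beta>) \<Longrightarrow> indiscernible L C A' (I \<beta>)"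
    by blast
  have mut: "mutually_indiscernible L C M (Field \<kappa>) I"
    using I0(2) by (rule mutually_indiscernible_transfer) (use I(5,6) in auto)

  define N where "N = (SIGMA \<beta>:Field \<kappa>. points (I \<beta>) \<times> coords (I \<beta>))"
  define e where "e = case_sum b (\<lambda>(\<beta>, l, j). entry (I \<beta>) l j)"
  have "small (Field \<kappa>)"
    using card_of_Field_ordIso[OF \<kappa>(1)] \<kappa>(2) by (rule ordIso_ordLess_trans)
  then have "small N" unfolding N_def using I(2,3) by (rule small_family)
  then obtain e' where e': "coheir_copy M A (X <+> N) e e'"
    using coheir_copy_exists[OF small_Plus[OF \<open>small X\<close>]] assms(5,6) by blast
  define b' where "b' = e' \<circ> Inl"
  define I' where "I' \<beta> = (I \<beta>)\<lparr>entry := \<lambda>l j. e' (Inr (\<beta>, l, j))\<rparr>" for \<beta>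
  \<comment> \<open>The variables for the coordinates of the tuples with indices \<open>i\<close> in the \<open>\<beta>\<close>-th sequence;
    the parameters are handled by \<open>\<nu>\<close>.\<close>
  define \<sigma> :: "'k \<Rightarrow> (nat \<Rightarrow> 'k) \<Rightarrow> ('m \<Rightarrow> ('x + 'k \<times> 'k \<times> 'k) + 'm) \<Rightarrow> (nat \<times> 'k) + 'm \<Rightarrow> _"
    where "\<sigma> \<beta> i \<nu> = case_sum (\<lambda>(k, j). Inl (Inr (\<beta>, i k, j))) \<nu>" for \<beta> i \<nu>
  have \<sigma>: "case_sum e h \<circ> \<sigma> \<beta> i \<nu> = seq_env (I \<beta>) i \<circ> map_sum id (case_sum e h \<circ> \<nu>)"
    "case_sum e' h \<circ> \<sigma> \<beta> i \<nu> = seq_env (I' \<beta>) i \<circ> map_sum id (case_sum e' h \<circ> \<nu>)" for \<beta> i \<nu> h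
    by (rule ext, auto simp: \<sigma>_def e_def I'_def split: sum.split)+
  have \<sigma>_range: "\<sigma> \<beta> i \<nu> ` (({..<n} \<times> coords (I \<beta>)) <+> P) \<subseteq> (X <+> N) <+> A"
    if "\<beta> \<in> Field \<kappa>" "increasing (I \<beta>) n i" "\<nu> ` P \<subseteq> (X <+> N) <+> A" for \<beta> n i \<nu> P
    using that by (auto simp: \<sigma>_def N_def increasing_def)
  have incr: "increasing (I' \<beta>) = increasing (I \<beta>)" for \<beta>
    by (intro ext) (simp add: increasing_def I'_def)
  have coords: "coords (I' \<beta>) = coords (I \<beta>)" for \<beta> by (simp add: I'_def)
  have range_h: "h u \<in> M" if "range h \<subseteq> M" for h :: "'m \<Rightarrow> 'm" and u using that by blast

  have "mutually_indiscernible L C A (Field \<kappa>) I'"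
    unfolding mutually_indiscernible_def indiscernible_def
  proof (intro allI impI ballI)
    fix \<alpha> n i i' \<chi>
    let ?P = "A \<union> (\<Union>\<beta>\<in>Field \<kappa> - {\<alpha>}. elems (I' \<beta>))"
    let ?N = "SIGMA \<beta>:Field \<kappa> - {\<alpha>}. points (I \<beta>) \<times> coords (I \<beta>)"
    assume \<alpha>: "\<alpha> \<in> Field \<kappa>" and "increasing (I' \<alpha>) n i" "increasing (I' \<alpha>) n i'"
      and "\<chi> \<in> formulas L (({..<n} \<times> coords (I' \<alpha>)) <+> ?P)"
    then have i: "increasing (I \<alpha>) n i" "increasing (I \<alpha>) n i'"
      and \<chi>: "\<chi> \<in> formulas L (({..<n} \<times> coords (I \<alpha>)) <+> ?P)" by (simp_all add: incr coords)
    have "\<forall>u\<in>?P. \<exists>v. v \<in> Inl ` Inr ` ?N \<union> Inr ` A \<and> case_sum e' id v = u"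
    proof
      fix u assume "u \<in> ?P"
      then consider "u \<in> A" | \<beta> l j where "\<beta> \<in> Field \<kappa> - {\<alpha>}" "l \<in> points (I \<beta>)" "j \<in> coords (I \<beta>)"
        "u = e' (Inr (\<beta>, l, j))"
        by (auto simp: elems_def I'_def)
      then show "\<exists>v. v \<in> Inl ` Inr ` ?N \<union> Inr ` A \<and> case_sum e' id v = u"
      proof cases
        case 1
        then show ?thesis by (intro exI[of _ "Inr u"]) auto
      next
        case 2
        then show ?thesis by (intro exI[of _ "Inl (Inr (\<beta>, l, j))"]) auto
      qed
    qed
    \<comment> \<open>Every parameter is an element of \<open>A\<close> or the value of a variable, which \<open>\<nu>\<close> chooses.\<close>
    from bchoice[OF this] obtain \<nu>
      where \<nu>': "\<forall>u\<in>?P. \<nu> u \<in> Inl ` Inr ` ?N \<union> Inr ` A \<and> case_sum e' id (\<nu> u) = u" ..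
    have \<nu>: "\<nu> u \<in> Inl ` Inr ` ?N \<union> Inr ` A" "case_sum e' id (\<nu> u) = u" if "u \<in> ?P" for u
      using bspec[OF \<nu>' that] by blast+
    have "\<nu> ` ?P \<subseteq> Inl ` Inr ` ?N \<union> Inr ` A" using \<nu>(1) by blast
    also have "\<dots> \<subseteq> (X <+> N) <+> A" by (auto simp: N_def)
    finally have \<nu>P: "\<nu> ` ?P \<subseteq> (X <+> N) <+> A" .
    define Q where "Q \<epsilon> \<longleftrightarrow> (holds C (\<epsilon> \<circ> \<sigma> \<alpha> i \<nu>) \<chi> \<longleftrightarrow> holds C (\<epsilon> \<circ> \<sigma> \<alpha> i' \<nu>) \<chi>)" for \<epsilon>
    have "expressible L C ((X <+> N) <+> A) Q"
      unfolding Q_def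
      by (intro expressible_iff expressible_rename[OF expressible_holds[OF \<chi>]] \<sigma>_range \<alpha> i \<nu>P)
    moreover have "Q (case_sum e h)" if h: "range h \<subseteq> M" for h
    proof -
      let ?f = "map_sum id (case_sum e h \<circ> \<nu>)"
      have "case_sum e h (\<nu> u) \<in> M \<union> (\<Union>\<beta>\<in>Field \<kappa> - {\<alpha>}. elems (I \<beta>))" if "u \<in> ?P" for u
      proof -
        from \<nu>(1)[OF that] consider a where "\<nu> u = Inr a"
          | \<beta> l j where "\<beta> \<in> Field \<kappa> - {\<alpha>}" "l \<in> points (I \<beta>)" "j \<in> coords (I \<beta>)" "\<nu> u = Inl (Inr (\<beta>, l, j))"
          by blast
        then show ?thesis
        proof cases
          case 1
          then show ?thesis using range_h[OF h] by simp
        next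
          case 2
          then have "case_sum e h (\<nu> u) \<in> elems (I \<beta>)" by (auto simp: e_def elems_def)
          then show ?thesis using 2(1) by blast
        qed
      qed
      then have "?f ` (({..<n} \<times> coords (I \<alpha>)) <+> ?P) \<subseteq>
          ({..<n} \<times> coords (I \<alpha>)) <+> (M \<union> (\<Union>\<beta>\<in>Field \<kappa> - {\<alpha>}. elems (I \<beta>)))"
        by (intro map_sum_id_image) (simp only: o_apply)
      from map_formulasI[OF \<chi> this] mut \<alpha> i
      have "holds C (seq_env (I \<alpha>) i) (map_fm ?f \<chi>) \<longleftrightarrow> holds C (seq_env (I \<alpha>) i') (map_fm ?f \<chi>)"
        by (intro indiscernibleD) (simp_all add: mutually_indiscernible_def)
      then show ?thesis unfolding Q_def \<sigma> sat_map .
    qed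
    ultimately have "Q (case_sum e' id)" using coheir_copyD[OF e'] by blast
    moreover have "holds C (case_sum e' id \<circ> \<sigma> \<alpha> i \<nu>) \<chi> \<longleftrightarrow> holds C (seq_env (I' \<alpha>) i) \<chi>" for i
      unfolding \<sigma>
    proof (rule sat_cong)
      fix v assume "v \<in> fv \<chi>"
      then have "v \<in> ({..<n} \<times> coords (I \<alpha>)) <+> ?P" using \<chi> by (auto simp: formulas_def)
      then show "(seq_env (I' \<alpha>) i \<circ> map_sum id (case_sum e' id \<circ> \<nu>)) v = seq_env (I' \<alpha>) i v"
      proof (rule PlusE)
        fix u assume "u \<in> ?P" "v = Inr u"
        then show ?thesis using \<nu>(2)[OF \<open>u \<in> ?P\<close>] by simp
      qed simp
    qed
    ultimately show "holds C (seq_env (I' \<alpha>) i) \<chi> \<longleftrightarrow> holds C (seq_env (I' \<alpha>) i') \<chi>"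
      by (simp add: Q_def)
  qed
  moreover have "realizes C b' p"
    unfolding b'_def
    by (rule coheir_copy_realizes[OF p e']) (use b in \<open>auto simp: e_def case_sum_o_inj\<close>)
  moreover have "infinite_sequence \<mu> (I' \<beta>)" if "\<beta> \<in> Field \<kappa>" for \<beta>
    using I(1)[OF that] by (simp add: infinite_sequence_def I'_def)
  ultimately obtain \<beta> where \<beta>: "\<beta> \<in> Field \<kappa>" and ind: "indiscernible L C (b' ` X \<union> A) (I' \<beta>)"
    using dpr unfolding dpr_less_def by blast

  \<comment> \<open>The failure of indiscernibility of the original sequence over \<open>b M\<close> is also copied.\<close>
  from I(4)[OF \<beta>] obtain n i i' \<phi> where i: "increasing (I \<beta>) n i" "increasing (I \<beta>) n i'"
    and \<phi>: "\<phi> \<in> formulas L (({..<n} \<times> coords (I \<beta>)) <+> (b ` X \<union> M))"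
    "holds C (seq_env (I \<beta>) i) \<phi>" "\<not> holds C (seq_env (I \<beta>) i') \<phi>"
    by (rule not_indiscernibleE)
  define \<nu> :: "'m \<Rightarrow> ('x + 'k \<times> 'k \<times> 'k) + 'm"
    where "\<nu> u = (if u \<in> M then Inr u else Inl (Inl (inv_into X b u)))" for u
  have \<nu>_in: "\<nu> u \<in> Inl ` Inl ` X \<union> Inr ` M" if "u \<in> b ` X \<union> M" for u
    using that by (auto simp: \<nu>_def inv_into_into)
  have \<nu>P: "\<nu> ` (b ` X \<union> M) \<subseteq> (X <+> N) <+> A"
  proof (rule image_subsetI)
    fix u assume "u \<in> b ` X \<union> M"
    from \<nu>_in[OF this] \<open>M \<subseteq> A\<close> show "\<nu> u \<in> (X <+> N) <+> A" by auto
  qed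
  define Q where "Q \<epsilon> \<longleftrightarrow> holds C (\<epsilon> \<circ> \<sigma> \<beta> i \<nu>) \<phi> \<and> \<not> holds C (\<epsilon> \<circ> \<sigma> \<beta> i' \<nu>) \<phi>" for \<epsilon>
  have "expressible L C ((X <+> N) <+> A) Q"
    unfolding Q_def
    by (intro expressible_conj expressible_neg expressible_rename[OF expressible_holds[OF \<phi>(1)]]
        \<sigma>_range \<beta> i \<nu>P)
  moreover have "Q (case_sum e h)" if h: "\<And>m. m \<in> M \<Longrightarrow> h m = m" for h
  proof -
    have "holds C (case_sum e h \<circ> \<sigma> \<beta> i \<nu>) \<phi> \<longleftrightarrow> holds C (seq_env (I \<beta>) i) \<phi>" for i
      unfolding \<sigma>
    proof (rule sat_cong)
      fix v assume "v \<in> fv \<phi>"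
      then have "v \<in> ({..<n} \<times> coords (I \<beta>)) <+> (b ` X \<union> M)" using \<phi>(1) by (auto simp: formulas_def)
      then show "(seq_env (I \<beta>) i \<circ> map_sum id (case_sum e h \<circ> \<nu>)) v = seq_env (I \<beta>) i v"
        by (auto elim!: PlusE simp: \<nu>_def h e_def f_inv_into_f)
    qed
    then show ?thesis using \<phi>(2,3) by (simp add: Q_def)
  qed
  ultimately have Q: "Q (case_sum e' id)" using coheir_copyD[OF e'] by blast
  let ?f = "map_sum id (case_sum e' id \<circ> \<nu>)"
  have "case_sum e' id (\<nu> u) \<in> b' ` X \<union> A" if "u \<in> b ` X \<union> M" for u
    using \<nu>_in[OF that] \<open>M \<subseteq> A\<close> by (auto simp: b'_def)
  then have "?f ` (({..<n} \<times> coords (I \<beta>)) <+> (b ` X \<union> M)) \<subseteq> ({..<n} \<times> coords (I \<beta>)) <+> (b' ` X \<union> A)"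
    by (intro map_sum_id_image) (simp only: o_apply)
  from map_formulasI[OF \<phi>(1) this] i
  have "holds C (seq_env (I' \<beta>) i) (map_fm ?f \<phi>) \<longleftrightarrow> holds C (seq_env (I' \<beta>) i') (map_fm ?f \<phi>)"
    by (intro indiscernibleD[OF ind]) (simp_all add: incr coords)
  then show False using Q unfolding Q_def \<sigma> sat_map by blast
qed

end


section \<open>Counting formulas\<close>

context
  fixes K :: "'a set"
  assumes K: "infinite K"
begin

private abbreviation at_most_K :: "'b set \<Rightarrow> bool" where
  "at_most_K S \<equiv> |S| \<le>o |K|"

private lemma image_at_most_K: "at_most_K S \<Longrightarrow> at_most_K (f ` S)"
  using card_of_image ordLeq_transitive by blast

private lemma Un_at_most_K: "at_most_K R \<Longrightarrow> at_most_K S \<Longrightarrow> at_most_K (R \<union> S)"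
  by (intro card_of_Un_ordLeq_infinite_Field) (simp_all add: Field_card_of card_of_card_order_on K)

private lemma Times_at_most_K: "at_most_K R \<Longrightarrow> at_most_K S \<Longrightarrow> at_most_K (R \<times> S)"
  by (intro card_of_Times_ordLeq_infinite_Field) (simp_all add: Field_card_of card_of_card_order_on K)

private lemma nat_at_most_K: "at_most_K (UNIV :: nat set)"
  using K by (simp add: infinite_iff_card_of_nat)

private lemma UN_nat_at_most_K: "(\<And>n :: nat. at_most_K (S n)) \<Longrightarrow> at_most_K (\<Union>n. S n)"
  using card_of_UNION_ordLeq_infinite[OF K nat_at_most_K, of S] by blast

private lemma empty_at_most_K: "at_most_K {}"
  by (rule card_of_empty)

private lemma lists_at_most_K:
  assumes S: "at_most_K S"
  shows "at_most_K (lists S)"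
proof -
  have "at_most_K {xs \<in> lists S. length xs = n}" for n
  proof (induction n)
    case 0
    have "{xs \<in> lists S. length xs = 0} = (\<lambda>_. []) ` {0 :: nat}" by auto
    moreover have "at_most_K ((\<lambda>_. []) ` {0 :: nat})"
      using ordLeq_transitive[OF card_of_mono1[OF subset_UNIV] nat_at_most_K] by (rule image_at_most_K)
    ultimately show ?case by (simp only:)
  next
    case (Suc n)
    let ?cons = "(\<lambda>(x, xs). x # xs) ` (S \<times> {xs \<in> lists S. length xs = n})"
    have "{xs \<in> lists S. length xs = Suc n} \<subseteq> ?cons"
    proof
      fix zs assume "zs \<in> {xs \<in> lists S. length xs = Suc n}"
      then obtain x xs where "zs = x # xs" "x \<in> S" "xs \<in> lists S" "length xs = n"
        by (cases zs) auto
      then show "zs \<in> ?cons" by (intro image_eqI[of _ _ "(x, xs)"]) simp_all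
    qed
    have "at_most_K ?cons" by (intro image_at_most_K Times_at_most_K S Suc.IH)
    from ordLeq_transitive[OF card_of_mono1[OF \<open>_ \<subseteq> ?cons\<close>] this] show ?case .
  qed
  then have "at_most_K (\<Union>n. {xs \<in> lists S. length xs = n})" by (rule UN_nat_at_most_K)
  moreover have "lists S = (\<Union>n. {xs \<in> lists S. length xs = n})" by auto
  ultimately show ?thesis by (simp only:)
qed

text \<open>The formulas are exhausted by countably many strata, namely by the bounds on their depth.\<close>

private primrec trms :: "('f, 'r) lang \<Rightarrow> 'v set \<Rightarrow> nat \<Rightarrow> ('f, 'v) trm set" where
  "trms L V 0 = {}"
| "trms L V (Suc d) = Var ` V \<union> (range Bnd \<union> (\<lambda>((f, n), ts). App f ts) ` (Funs L \<times> lists (trms L V d)))"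

private primrec fms :: "('f, 'r) lang \<Rightarrow> 'v set \<Rightarrow> nat \<Rightarrow> ('f, 'r, 'v) fm set" where
  "fms L V 0 = {}"
| "fms L V (Suc d) =
    (\<lambda>(t, u). Eq t u) ` ((\<Union>c. trms L V c) \<times> (\<Union>c. trms L V c)) \<union>
    ((\<lambda>((R, n), ts). Rel R ts) ` (Rels L \<times> lists (\<Union>c. trms L V c)) \<union>
    (Neg ` fms L V d \<union> ((\<lambda>(\<phi>, \<psi>). Conj \<phi> \<psi>) ` (fms L V d \<times> fms L V d) \<union> Ex ` fms L V d)))"

private lemma trms_mono: "c \<le> d \<Longrightarrow> trms L V c \<subseteq> trms L V d"
proof (induction c arbitrary: d)
  case (Suc c)
  then obtain d' where d: "d = Suc d'" "c \<le> d'" by (cases d) auto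
  have "lists (trms L V c) \<subseteq> lists (trms L V d')" using Suc.IH[OF d(2)] by (rule lists_mono)
  then show ?case unfolding d(1) trms.simps by blast
qed simp

private lemma fms_mono: "c \<le> d \<Longrightarrow> fms L V c \<subseteq> fms L V d"
proof (induction c arbitrary: d)
  case (Suc c)
  then obtain d' where d: "d = Suc d'" "c \<le> d'" by (cases d) auto
  show ?case using Suc.IH[OF d(2)] unfolding d(1) fms.simps by blast
qed simp

private lemma trm_in_trms: "wf_trm L n t \<Longrightarrow> tfv t \<subseteq> V \<Longrightarrow> \<exists>d. t \<in> trms L V d"
proof (induction t)
  case (Var v)
  then have "Var v \<in> trms L V (Suc 0)" by simp
  then show ?case ..
next
  case (Bnd i)
  have "Bnd i \<in> trms L V (Suc 0)" by simp
  then show ?case ..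
next
  case (App f ts)
  have "\<forall>t\<in>set ts. \<exists>d. t \<in> trms L V d" using App by auto
  from bchoice[OF this] obtain d where d: "\<forall>t\<in>set ts. t \<in> trms L V (d t)" ..
  have "t \<in> trms L V (Max (d ` set ts))" if "t \<in> set ts" for t
    using d that trms_mono[of "d t" "Max (d ` set ts)" L V] by auto
  then have "ts \<in> lists (trms L V (Max (d ` set ts)))" by auto
  with App.prems(1) have "App f ts \<in> trms L V (Suc (Max (d ` set ts)))"
    unfolding trms.simps by (intro UnI2 image_eqI[of _ _ "((f, length ts), ts)"]) simp_all
  then show ?case ..
qed

private lemma fm_in_fms: "wf_fm L n \<phi> \<Longrightarrow> fv \<phi> \<subseteq> V \<Longrightarrow> \<exists>d. \<phi> \<in> fms L V d"
proof (induction \<phi> arbitrary: n)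
  case (Eq t u)
  then have "t \<in> (\<Union>c. trms L V c)" "u \<in> (\<Union>c. trms L V c)"
    using trm_in_trms[of L n] by auto
  then have "Eq t u \<in> fms L V (Suc 0)"
    unfolding fms.simps by (intro UnI1 image_eqI[of _ _ "(t, u)"]) simp_all
  then show ?case ..
next
  case (Rel R ts)
  then have "t \<in> (\<Union>c. trms L V c)" if "t \<in> set ts" for t
    using that trm_in_trms[of L n t V] by fastforce
  then have "ts \<in> lists (\<Union>c. trms L V c)" by (simp add: in_lists_conv_set)
  with Rel.prems(1) have "Rel R ts \<in> fms L V (Suc 0)"
    unfolding fms.simps by (intro UnI2 UnI1 image_eqI[of _ _ "((R, length ts), ts)"]) simp_all
  then show ?case ..
next
  case (Neg \<phi>)
  then obtain d where "\<phi> \<in> fms L V d" by auto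
  then have "Neg \<phi> \<in> fms L V (Suc d)" by simp
  then show ?case ..
next
  case (Conj \<phi> \<psi>)
  then obtain c d where "\<phi> \<in> fms L V c" "\<psi> \<in> fms L V d" by fastforce
  then have "\<phi> \<in> fms L V (max c d)" "\<psi> \<in> fms L V (max c d)"
    using fms_mono[of c "max c d" L V] fms_mono[of d "max c d" L V] by auto
  then have "Conj \<phi> \<psi> \<in> fms L V (Suc (max c d))"
    unfolding fms.simps by (intro UnI2 UnI1 image_eqI[of _ _ "(\<phi>, \<psi>)"] UnI2) simp_all
  then show ?case ..
next
  case (Ex \<phi>)
  then obtain d where "\<phi> \<in> fms L V d" by auto
  then have "Ex \<phi> \<in> fms L V (Suc d)" by simp
  then show ?case ..
qed

lemma card_formulas:
  assumes "|V| \<le>o |K|" "|Funs L| \<le>o |K|" "|Rels L| \<le>o |K|"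
  shows "|formulas L V| \<le>o |K|"
proof -
  have t: "at_most_K (trms L V d)" for d
    by (induction d)
      (simp_all add: empty_at_most_K Un_at_most_K image_at_most_K Times_at_most_K lists_at_most_K
        nat_at_most_K assms)
  have "at_most_K (fms L V d)" for d
    by (induction d)
      (simp_all add: empty_at_most_K Un_at_most_K image_at_most_K Times_at_most_K lists_at_most_K
        UN_nat_at_most_K t assms)
  then have "at_most_K (\<Union>d. fms L V d)" by (rule UN_nat_at_most_K)
  moreover have "formulas L V \<subseteq> (\<Union>d. fms L V d)"
    using fm_in_fms by (fastforce simp: formulas_def)
  ultimately show ?thesis using card_of_mono1 ordLeq_transitive by blast
qed

end


section \<open>Binary trees and definability of types\<close>

text \<open>
  A full binary tree of height \<open>n\<close> of parameters for the relation \<open>E\<close>, each branch of which is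
  realized inside \<open>P\<close>; equivalently, Shelah's local rank of \<open>P\<close> is at least \<open>n\<close>.
\<close>

primrec has_tree :: "('a \<Rightarrow> 'c \<Rightarrow> bool) \<Rightarrow> nat \<Rightarrow> ('a \<Rightarrow> bool) \<Rightarrow> bool" where
  "has_tree E 0 P \<longleftrightarrow> (\<exists>x. P x)"
| "has_tree E (Suc n) P \<longleftrightarrow>
     (\<exists>c. has_tree E n (\<lambda>x. P x \<and> E x c) \<and> has_tree E n (\<lambda>x. P x \<and> \<not> E x c))"

text \<open>
  A path through a tree of height \<open>k\<close> can be chosen so as to disagree with \<open>k\<close> given predicates,
  one at each node, as long as the predicate \<open>G i\<close> depends on nodes of a level smaller than that of
  \<open>i\<close> only, besides the node \<open>i\<close> itself.
\<close>

lemma diagonal_path: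
  fixes G :: "nat \<times> 'q \<Rightarrow> ((nat \<times> 'q) \<times> 'y \<Rightarrow> 'm) \<Rightarrow> bool" and E :: "'a \<Rightarrow> ('y \<Rightarrow> 'm) \<Rightarrow> bool"
  assumes local: "\<And>i w w'. i \<in> I \<Longrightarrow> (\<And>y. w (i, y) = w' (i, y)) \<Longrightarrow>
      (\<And>j y. fst j < fst i \<Longrightarrow> w (j, y) = w' (j, y)) \<Longrightarrow> G i w \<longleftrightarrow> G i w'"
    and "set is \<subseteq> I" "sorted_wrt (\<lambda>i j. fst i \<le> fst j) is" "distinct is" "has_tree E (length is) P"
  shows "\<exists>w' x. (\<forall>i y. i \<notin> set is \<longrightarrow> w' (i, y) = w (i, y)) \<and> P x \<and>
    (\<forall>i\<in>set is. E x (\<lambda>y. w' (i, y)) \<longleftrightarrow> \<not> G i w')"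
  using assms(2-5)
proof (induction "is" arbitrary: P w)
  case Nil
  then show ?case by auto
next
  case (Cons i "is")
  from Cons.prems(4) obtain c where c: "has_tree E (length is) (\<lambda>x. P x \<and> E x c)"
    "has_tree E (length is) (\<lambda>x. P x \<and> \<not> E x c)" by auto
  define w\<^sub>1 where "w\<^sub>1 = (\<lambda>(j, y). if j = i then c y else w (j, y))"
  \<comment> \<open>Once the root has its parameter \<open>c\<close>, the predicate \<open>G i\<close> dictates the side on which to go on.\<close>
  let ?P = "\<lambda>x. P x \<and> (E x c \<longleftrightarrow> \<not> G i w\<^sub>1)"
  have "has_tree E (length is) ?P" using c by (cases "G i w\<^sub>1") auto
  with Cons.IH[of ?P w\<^sub>1] Cons.prems obtain w' x where
    w': "\<forall>j y. j \<notin> set is \<longrightarrow> w' (j, y) = w\<^sub>1 (j, y)" "?P x"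
      "\<forall>j\<in>set is. E x (\<lambda>y. w' (j, y)) \<longleftrightarrow> \<not> G j w'"
    by auto
  have i: "w' (i, y) = c y" for y using w'(1)[rule_format, of i] Cons.prems(3) by (simp add: w\<^sub>1_def)
  have "G i w' \<longleftrightarrow> G i w\<^sub>1"
  proof (rule local)
    show "i \<in> I" using Cons.prems(1) by simp
    show "w' (i, y) = w\<^sub>1 (i, y)" for y using i by (simp add: w\<^sub>1_def)
    fix j :: "nat \<times> 'q" and y assume "fst j < fst i"
    with Cons.prems(2) have "j \<notin> set is" by fastforce
    then show "w' (j, y) = w\<^sub>1 (j, y)" using w'(1) by blast
  qed
  then have "E x (\<lambda>y. w' (i, y)) \<longleftrightarrow> \<not> G i w'" using w'(2) by (simp add: i)
  moreover have "\<forall>j y. j \<notin> set (i # is) \<longrightarrow> w' (j, y) = w (j, y)"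
    using w'(1) by (simp add: w\<^sub>1_def)
  ultimately show ?case
    using w'(2,3) by (intro exI[of _ w'] exI[of _ x]) simp
qed

context monster
begin

abbreviation rel_of :: "('f, 'r, 'x + nat) fm \<Rightarrow> ('x \<Rightarrow> 'm) \<Rightarrow> (nat \<Rightarrow> 'm) \<Rightarrow> bool" where
  "rel_of \<phi> x c \<equiv> holds C (case_sum x c) \<phi>"

abbreviation sol :: "('f, 'r, 'x + 'm) fm \<Rightarrow> ('x \<Rightarrow> 'm) \<Rightarrow> bool" where
  "sol \<theta> x \<equiv> holds C (case_sum x id) \<theta>"

lemma sol_inst_right: "sol (inst_right c \<phi>) x \<longleftrightarrow> rel_of \<phi> x c"
proof -
  have "case_sum x id \<circ> map_sum id c = case_sum x c" by (auto simp: fun_eq_iff split: sum.split)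
  then show ?thesis by (simp add: inst_right_def sat_map)
qed

text \<open>
  Descending along a branch adds one tuple of parameters to \<open>P\<close> at each step.  The variables
  \<open>(k, y)\<close> with \<open>k < l\<close> stand for the \<open>l\<close> tuples chosen so far, and \<open>(l, y)\<close> is fresh for the next.
\<close>

lemma expressible_has_tree_levels:
  fixes X :: "'x set" and W :: "'w set" and Y :: "nat set" and l :: nat
  assumes \<phi>: "\<phi> \<in> formulas L (X <+> Y)"
    and "expressible L C (X <+> W <+> {..<l} \<times> Y) P"
  shows "expressible L C (W <+> {..<l} \<times> Y) (\<lambda>h. has_tree (rel_of \<phi>) n (\<lambda>x. P (case_sum x h)))"
  using assms(2)
proof (induction n arbitrary: P l)
  case 0
  then show ?case by (simp add: expressible_Ex)
next
  case (Suc n)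
  let ?\<iota> = "case_sum Inl (\<lambda>y. Inr (Inr (l, y)))"
  have P: "expressible L C (X <+> W <+> {..<Suc l} \<times> Y) P"
    using Suc.prems by (rule expressible_mono) auto
  have E: "expressible L C (X <+> W <+> {..<Suc l} \<times> Y) (\<lambda>\<epsilon>. holds C (\<epsilon> \<circ> ?\<iota>) \<phi>)"
    by (rule expressible_rename[OF expressible_holds[OF \<phi>]]) auto
  define R where "R h \<longleftrightarrow>
      has_tree (rel_of \<phi>) n (\<lambda>x. P (case_sum x h) \<and> holds C (case_sum x h \<circ> ?\<iota>) \<phi>) \<and>
      has_tree (rel_of \<phi>) n (\<lambda>x. P (case_sum x h) \<and> \<not> holds C (case_sum x h \<circ> ?\<iota>) \<phi>)" for h
  have "expressible L C (W <+> {..<Suc l} \<times> Y) R"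
    unfolding R_def
    by (intro expressible_conj Suc.IH[OF expressible_conj[OF P E]]
        Suc.IH[OF expressible_conj[OF P expressible_neg[OF E]]])
  from expressible_project[OF univ_C this, of "- (Inr ` ({l} \<times> UNIV))"]
  have "expressible L C (W <+> {..<l} \<times> Y) (\<lambda>h. \<exists>h'. (\<forall>v\<in>- (Inr ` ({l} \<times> UNIV)). h' v = h v) \<and> R h')"
    by (rule expressible_mono) auto
  moreover have "(\<exists>h'. (\<forall>v\<in>- (Inr ` ({l} \<times> UNIV)). h' v = h v) \<and> R h') \<longleftrightarrow>
      has_tree (rel_of \<phi>) (Suc n) (\<lambda>x. P (case_sum x h))" for h
  proof -
    have R: "R h' \<longleftrightarrow> has_tree (rel_of \<phi>) n (\<lambda>x. P (case_sum x h) \<and> rel_of \<phi> x (\<lambda>y. h' (Inr (l, y)))) \<and>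
        has_tree (rel_of \<phi>) n (\<lambda>x. P (case_sum x h) \<and> \<not> rel_of \<phi> x (\<lambda>y. h' (Inr (l, y))))"
      if "\<forall>v\<in>- (Inr ` ({l} \<times> UNIV)). h' v = h v" for h'
    proof -
      have "P (case_sum x h') \<longleftrightarrow> P (case_sum x h)" for x
        using that by (intro expressible_cong[OF Suc.prems]) auto
      moreover have "case_sum x h' \<circ> ?\<iota> = case_sum x (\<lambda>y. h' (Inr (l, y)))" for x :: "'x \<Rightarrow> 'm"
        by (auto simp: fun_eq_iff split: sum.split)
      ultimately show ?thesis by (simp add: R_def)
    qed
    show ?thesis
    proof
      assume "\<exists>h'. (\<forall>v\<in>- (Inr ` ({l} \<times> UNIV)). h' v = h v) \<and> R h'"
      then show "has_tree (rel_of \<phi>) (Suc n) (\<lambda>x. P (case_sum x h))" using R by auto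
    next
      assume "has_tree (rel_of \<phi>) (Suc n) (\<lambda>x. P (case_sum x h))"
      then obtain c where c: "has_tree (rel_of \<phi>) n (\<lambda>x. P (case_sum x h) \<and> rel_of \<phi> x c)"
        "has_tree (rel_of \<phi>) n (\<lambda>x. P (case_sum x h) \<and> \<not> rel_of \<phi> x c)" by auto
      define h' where "h' = case_sum (h \<circ> Inl) (\<lambda>(k, y). if k = l then c y else h (Inr (k, y)))"
      have h': "\<forall>v\<in>- (Inr ` ({l} \<times> UNIV)). h' v = h v" by (auto simp: h'_def split: sum.split)
      moreover have "(\<lambda>y. h' (Inr (l, y))) = c" by (simp add: h'_def)
      with c R[OF h'] have "R h'" by simp
      ultimately show "\<exists>h'. (\<forall>v\<in>- (Inr ` ({l} \<times> UNIV)). h' v = h v) \<and> R h'" by blast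
    qed
  qed
  ultimately show ?case by simp
qed

lemma expressible_has_tree:
  fixes X :: "'x set" and W :: "'w set"
  assumes \<phi>: "\<phi> \<in> formulas L (X <+> Y)" and P: "expressible L C (X <+> W) P"
  shows "expressible L C W (\<lambda>h. has_tree (rel_of \<phi>) n (\<lambda>x. P (case_sum x h)))"
proof -
  let ?f = "map_sum id Inl :: 'x + 'w \<Rightarrow> 'x + 'w + nat \<times> nat"
  have "expressible L C (X <+> W <+> {..<0 :: nat} \<times> Y) (\<lambda>\<epsilon>. P (\<epsilon> \<circ> ?f))"
    by (rule expressible_rename[OF P]) auto
  note tree = expressible_has_tree_levels[OF \<phi> this, of n]
  have "case_sum id (\<lambda>_. undefined) ` (W <+> {..<0 :: nat} \<times> Y) \<subseteq> W" by auto
  from expressible_rename[OF tree this]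
  have "expressible L C W (\<lambda>h. has_tree (rel_of \<phi>) n
      (\<lambda>x. P (case_sum x (h \<circ> case_sum id (\<lambda>_. undefined)) \<circ> ?f)))" .
  moreover have "case_sum x (h \<circ> case_sum id (\<lambda>_. undefined)) \<circ> ?f = case_sum x h" for x :: "'x \<Rightarrow> 'm" and h :: "'w \<Rightarrow> 'm"
    by (auto simp: fun_eq_iff map_sum_def split: sum.split)
  ultimately show ?thesis by simp
qed

lemma complete_type_realized:
  "q \<in> complete_types L C X B \<Longrightarrow> finite \<Delta> \<Longrightarrow> \<Delta> \<subseteq> q \<Longrightarrow> \<exists>x. realizes C x \<Delta>"
  by (simp add: complete_types_def consistent_def)

lemma complete_type_Neg:
  assumes "q \<in> complete_types L C X B" "\<theta> \<in> formulas L (X <+> B)"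
  shows "Neg \<theta> \<in> q \<longleftrightarrow> \<theta> \<notin> q"
proof
  assume neg: "Neg \<theta> \<in> q"
  show "\<theta> \<notin> q"
  proof
    assume "\<theta> \<in> q"
    with neg complete_type_realized[OF assms(1), of "{\<theta>, Neg \<theta>}"]
    obtain x where "realizes C x {\<theta>, Neg \<theta>}" by auto
    then show False by (simp add: realizes_def)
  qed
qed (use assms in \<open>auto simp: complete_types_def\<close>)

lemma complete_type_Conj:
  assumes "q \<in> complete_types L C X B" "\<theta> \<in> q" "\<eta> \<in> q"
  shows "Conj \<theta> \<eta> \<in> q"
proof (rule ccontr)
  assume "Conj \<theta> \<eta> \<notin> q"
  moreover have "Conj \<theta> \<eta> \<in> formulas L (X <+> B)"
    using assms by (simp add: complete_types_def subset_iff)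
  ultimately have "Neg (Conj \<theta> \<eta>) \<in> q" using assms(1) unfolding complete_types_def by blast
  with assms(2,3) complete_type_realized[OF assms(1), of "{\<theta>, \<eta>, Neg (Conj \<theta> \<eta>)}"]
  obtain x where "realizes C x {\<theta>, \<eta>, Neg (Conj \<theta> \<eta>)}" by auto
  then show False by (auto simp: realizes_def)
qed

text \<open>
  Let \<open>m\<close> be the largest number such that every formula in \<open>q\<close> has a tree of height \<open>m\<close>, and let
  \<open>\<theta> \<in> q\<close> have no tree of height \<open>m + 1\<close>.  At most one of \<open>\<theta> \<and> \<phi>(x, b)\<close> and \<open>\<theta> \<and> \<not> \<phi>(x, b)\<close> has
  a tree of height \<open>m\<close>, since otherwise \<open>b\<close> would be the root of a tree of height \<open>m + 1\<close> in \<open>\<theta>\<close>; and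
  the one in \<open>q\<close> does.  So \<open>\<phi>(x, b) \<in> q\<close> says that \<open>\<theta> \<and> \<phi>(x, b)\<close> has a tree of height \<open>m\<close>.
\<close>

lemma definable_if_bounded_trees:
  fixes X :: "'x set"
  assumes q: "q \<in> complete_types L C X B" and \<phi>: "\<phi> \<in> formulas L (X <+> Y)"
    and bounded: "\<theta>\<^sub>0 \<in> q" "\<not> has_tree (rel_of \<phi>) n\<^sub>0 (sol \<theta>\<^sub>0)"
  shows "\<exists>\<psi>\<in>formulas L (Y <+> B). \<forall>b. b ` Y \<subseteq> B \<longrightarrow>
    (inst_right b \<phi> \<in> q \<longleftrightarrow> holds C (case_sum b id) \<psi>)"
proof -
  define n where "n = (LEAST n. \<exists>\<theta>\<in>q. \<not> has_tree (rel_of \<phi>) n (sol \<theta>))"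
  have "\<exists>\<theta>\<in>q. \<not> has_tree (rel_of \<phi>) n\<^sub>0 (sol \<theta>)" using bounded by blast
  then have "\<exists>\<theta>\<in>q. \<not> has_tree (rel_of \<phi>) n (sol \<theta>)" unfolding n_def by (rule LeastI)
  then obtain \<theta> where \<theta>: "\<theta> \<in> q" "\<not> has_tree (rel_of \<phi>) n (sol \<theta>)" by blast
  have below: "has_tree (rel_of \<phi>) m (sol \<eta>)" if "m < n" "\<eta> \<in> q" for m \<eta>
    using that not_less_Least[of m] unfolding n_def by blast
  have q_sub: "q \<subseteq> formulas L (X <+> B)" using q by (simp add: complete_types_def)
  have "\<exists>x. sol \<theta> x"
    using complete_type_realized[OF q, of "{\<theta>}"] \<theta>(1) by (simp add: realizes_def)
  with \<theta>(2) have "n \<noteq> 0" by (cases n) auto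
  then obtain m where n: "n = Suc m" by (cases n) auto
  define P where "P \<epsilon> \<longleftrightarrow> holds C (\<epsilon> \<circ> map_sum id Inr) \<theta> \<and> holds C (\<epsilon> \<circ> map_sum id Inl) \<phi>" for \<epsilon>
  have "\<theta> \<in> formulas L (X <+> B)" using \<theta>(1) q_sub by blast
  then have "expressible L C (X <+> Y <+> B) P"
    unfolding P_def
    by (intro expressible_conj expressible_rename[OF expressible_holds]) (use \<phi> in auto)
  from expressible_has_tree[OF \<phi> this] obtain \<psi> where \<psi>: "\<psi> \<in> formulas L (Y <+> B)"
    "\<And>h. holds C h \<psi> \<longleftrightarrow> has_tree (rel_of \<phi>) m (\<lambda>x. P (case_sum x h))"
    unfolding expressible_def by blast
  have "inst_right b \<phi> \<in> q \<longleftrightarrow> holds C (case_sum b id) \<psi>" if b: "b ` Y \<subseteq> B" for b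
  proof -
    have "case_sum x (case_sum b id) \<circ> map_sum id Inr = case_sum x id"
      "case_sum x (case_sum b id) \<circ> map_sum id Inl = case_sum x b" for x :: "'x \<Rightarrow> 'm"
      by (auto simp: fun_eq_iff map_sum_def split: sum.split)
    then have \<psi>_iff: "holds C (case_sum b id) \<psi> \<longleftrightarrow>
        has_tree (rel_of \<phi>) m (\<lambda>x. sol \<theta> x \<and> rel_of \<phi> x b)"
      by (simp add: \<psi>(2) P_def)
    have inst: "inst_right b \<phi> \<in> formulas L (X <+> B)"
      unfolding inst_right_def using b by (intro map_formulasI[OF \<phi>]) auto
    show ?thesis
    proof
      assume "inst_right b \<phi> \<in> q"
      from below[OF _ complete_type_Conj[OF q \<theta>(1) this], of m] n
      show "holds C (case_sum b id) \<psi>" by (simp add: \<psi>_iff sol_inst_right)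
    next
      assume tree: "holds C (case_sum b id) \<psi>"
      show "inst_right b \<phi> \<in> q"
      proof (rule ccontr)
        assume "inst_right b \<phi> \<notin> q"
        then have "Neg (inst_right b \<phi>) \<in> q" using complete_type_Neg[OF q inst] by simp
        from below[OF _ complete_type_Conj[OF q \<theta>(1) this], of m] n
        have "has_tree (rel_of \<phi>) m (\<lambda>x. sol \<theta> x \<and> \<not> rel_of \<phi> x b)" by (simp add: sol_inst_right)
        with tree have "has_tree (rel_of \<phi>) n (sol \<theta>)" unfolding n \<psi>_iff by auto
        with \<theta>(2) show False by blast
      qed
    qed
  qed
  with \<psi>(1) show ?thesis by blast
qed

text \<open>A bound on the height of trees is expressible, so it descends along the definition of \<open>p\<close>.\<close>

lemma bounded_trees_restrict:
  fixes X :: "'x set"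
  assumes p: "p \<subseteq> formulas L (X <+> A)" "M \<subseteq> A" "definable_over L C X A p M"
    and M: "elementary_submodel L C M" and \<phi>: "\<phi> \<in> formulas L (X <+> Y)"
    and \<chi>: "\<chi> \<in> p" "\<not> has_tree (rel_of \<phi>) n (sol \<chi>)"
  obtains \<theta> where "\<theta> \<in> restrict_type L X p M" "\<not> has_tree (rel_of \<phi>) n (sol \<theta>)"
proof -
  from definable_type_substitution[OF p \<chi>(1)] obtain D where D: "expressible L C A D" "D id"
    "\<And>h. range h \<subseteq> M \<Longrightarrow> (\<And>m. m \<in> M \<Longrightarrow> h m = m) \<Longrightarrow> D h \<Longrightarrow>
      map_fm (map_sum id h) \<chi> \<in> restrict_type L X p M" by blast
  have "\<chi> \<in> formulas L (X <+> A)" using \<chi>(1) p(1) by blast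
  define Q where "Q = (\<lambda>h. D h \<and> \<not> has_tree (rel_of \<phi>) n (\<lambda>x. holds C (case_sum x h) \<chi>))"
  have "expressible L C A Q"
    unfolding Q_def
    by (intro expressible_conj D(1) expressible_neg expressible_has_tree[OF \<phi>] expressible_holds) fact
  moreover have "Q id" using D(2) \<chi>(2) by (simp add: Q_def)
  ultimately obtain h where h: "range h \<subseteq> M" "\<And>m. m \<in> M \<Longrightarrow> h m = m" "Q h"
    using tarski_vaught[OF M] by blast
  have "sol (map_fm (map_sum id h) \<chi>) = (\<lambda>x. holds C (case_sum x h) \<chi>)"
  proof
    fix x :: "'x \<Rightarrow> 'm"
    have "case_sum x id \<circ> map_sum id h = case_sum x h"
      by (auto simp: fun_eq_iff map_sum_def split: sum.split)
    then show "sol (map_fm (map_sum id h) \<chi>) x = holds C (case_sum x h) \<chi>" by (simp add: sat_map)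
  qed
  with h(3) have "\<not> has_tree (rel_of \<phi>) n (sol (map_fm (map_sum id h) \<chi>))" by (simp add: Q_def)
  moreover have "D h" using h(3) by (simp add: Q_def)
  ultimately show thesis using that D(3)[OF h(1,2)] by blast
qed

text \<open>
  The converse: an extension of \<open>p\<close> that is not definable is built by diagonalization.  Its
  parameters are the values of new names, each of which belongs to some level.  The names of level
  \<open>n\<close> enumerate the formulas \<open>\<psi>(y)\<close> whose parameters are in \<open>A\<close> or have names of smaller levels, and
  the parameter \<open>z\<close> named by \<open>\<psi>\<close> is subject to \<open>\<phi>(x, z) \<longleftrightarrow> \<not> \<psi>(z)\<close>.  Trees in \<open>p\<close> make any finitely
  many of these conditions consistent with \<open>p\<close>; and no formula over \<open>A\<close> and the new parameters can
  define the resulting type, because every such formula has a name.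
\<close>

lemma stable_imp_bounded_trees:
  fixes a :: "'x \<Rightarrow> 'm"
  assumes "small X" "small A" and p: "p = tp L C X a A" and stable: "stable L C \<mu> X A p"
    and Y: "finite (Y :: nat set)" and \<phi>: "\<phi> \<in> formulas L (X <+> Y)"
  shows "\<exists>n. \<exists>\<theta>\<in>p. \<not> has_tree (rel_of \<phi>) n (sol \<theta>)"
proof (rule ccontr)
  assume "\<not> ?thesis"
  then have trees: "has_tree (rel_of \<phi>) n (sol \<theta>)" if "\<theta> \<in> p" for n \<theta> using that by blast
  \<comment> \<open>A small set large enough to enumerate the formulas that are to be named at each level.\<close>
  define K where "K = A <+> Funs L <+> Rels L <+> (UNIV :: nat set)"
  have "infinite K" by (simp add: K_def finite_Plus_iff)
  have "small (Funs L)" "small (Rels L)" using monster by (simp_all add: monster_model_def)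
  then have "small K" unfolding K_def by (intro small_Plus small_nat \<open>small A\<close>)
  have FK: "infinite (Field |K| )" unfolding Field_card_of by (rule \<open>infinite K\<close>)
  have nat_K: "|S| \<le>o |K|" for S :: "nat set"
    using \<open>infinite K\<close> ordLeq_transitive[OF card_of_mono1[OF subset_UNIV]]
    by (auto simp: infinite_iff_card_of_nat)
  have A_K: "|A| \<le>o |K|" unfolding K_def by (rule card_of_Plus1)
  have funs_K: "|Funs L| \<le>o |K|" unfolding K_def
    by (rule ordLeq_transitive[OF card_of_Plus1 card_of_Plus2])
  have rels_K: "|Rels L| \<le>o |K|" unfolding K_def
    by (rule ordLeq_transitive[OF ordLeq_transitive[OF card_of_Plus1 card_of_Plus2] card_of_Plus2])
  define F where "F n = formulas L (Y <+> (({..<n} \<times> K) \<times> Y) <+> A)" for n :: nat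
  have "|F n| \<le>o |K|" for n
    unfolding F_def
    by (intro card_formulas[OF \<open>infinite K\<close>] funs_K rels_K nat_K A_K
        card_of_Plus_ordLeq_infinite_Field[OF FK] card_of_Times_ordLeq_infinite_Field[OF FK]
        card_of_Card_order ordLeq_refl)
  then have "\<exists>g. g ` K = F n" for n
    using card_of_ordLeq2[of "F n" K] Truth_formulas unfolding F_def by blast
  then obtain g where g: "\<And>n. g n ` K = F n" by metis
  define I where "I = (UNIV :: nat set) \<times> K"
  define V where "V = X <+> (I \<times> Y)"
  have "small (I \<times> Y)" unfolding I_def by (intro small_Times small_nat \<open>small K\<close> small_finite Y)
  then have "small V" unfolding V_def by (rule small_Plus[OF \<open>small X\<close>])
  have gF: "g (fst i) (snd i) \<in> F (fst i)" if "i \<in> I" for i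
    using that g[of "fst i", symmetric] by (simp add: I_def mem_Times_iff)
  define G where "G i w \<longleftrightarrow> holds C (case_sum (\<lambda>y. w (i, y)) (case_sum w id)) (g (fst i) (snd i))" for i w
  \<comment> \<open>Where the variables of \<open>\<phi>\<close> and of the formula named by \<open>i\<close> are found.\<close>
  define \<kappa> :: "_ \<Rightarrow> 'x + nat \<Rightarrow> ('x + _) + 'm"
    where "\<kappa> i = case_sum (\<lambda>x. Inl (Inl x)) (\<lambda>y. Inl (Inr (i, y)))"
    for i :: "nat \<times> ('m + 'f \<times> nat + 'r \<times> nat + nat)"
  define \<gamma> :: "_ \<Rightarrow> nat + _ + 'm \<Rightarrow> ('x + _) + 'm"
    where "\<gamma> i = case_sum (\<lambda>y. Inl (Inr (i, y))) (case_sum (\<lambda>w. Inl (Inr w)) Inr)"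
    for i :: "nat \<times> ('m + 'f \<times> nat + 'r \<times> nat + nat)"
  have "\<exists>\<delta>\<in>formulas L (V <+> A). \<forall>\<epsilon>. holds C \<epsilon> \<delta> \<longleftrightarrow>
      (holds C (\<epsilon> \<circ> \<kappa> i) \<phi> \<longleftrightarrow> \<not> holds C (\<epsilon> \<circ> \<gamma> i) (g (fst i) (snd i)))" if "i \<in> I" for i
    unfolding expressible_def[symmetric]
    by (intro expressible_iff expressible_neg expressible_rename[OF expressible_holds[OF \<phi>]]
        expressible_rename[OF expressible_holds[OF gF[OF that, unfolded F_def]]])
      (use that in \<open>auto simp: \<kappa>_def \<gamma>_def V_def I_def\<close>)
  then obtain \<delta> where \<delta>: "\<And>i. i \<in> I \<Longrightarrow> \<delta> i \<in> formulas L (V <+> A)"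
    "\<And>i \<epsilon>. i \<in> I \<Longrightarrow> holds C \<epsilon> (\<delta> i) \<longleftrightarrow>
      (holds C (\<epsilon> \<circ> \<kappa> i) \<phi> \<longleftrightarrow> \<not> holds C (\<epsilon> \<circ> \<gamma> i) (g (fst i) (snd i)))" by metis
  have \<kappa>: "case_sum e id \<circ> \<kappa> i = case_sum (e \<circ> Inl) (\<lambda>y. e (Inr (i, y)))"
    and \<gamma>: "case_sum e id \<circ> \<gamma> i = case_sum (\<lambda>y. e (Inr (i, y))) (case_sum (e \<circ> Inr) id)"
    for i and e :: "_ \<Rightarrow> 'm"
    by (rule ext, auto simp: \<kappa>_def \<gamma>_def split: sum.split)+
  have \<delta>_iff: "holds C (case_sum e id) (\<delta> i) \<longleftrightarrow>
      (rel_of \<phi> (e \<circ> Inl) (\<lambda>y. e (Inr (i, y))) \<longleftrightarrow> \<not> G i (e \<circ> Inr))" if "i \<in> I" for i e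
    using \<delta>(2)[OF that, of "case_sum e id"] by (simp add: \<kappa> \<gamma> G_def)

  have p_sub: "p \<subseteq> formulas L (X <+> A)" by (auto simp: p tp_def)
  let ?\<eta> = "map_fm (map_sum Inl id)"
  have \<eta>: "holds C (case_sum e id) (?\<eta> \<chi>) \<longleftrightarrow> sol \<chi> (e \<circ> Inl)" for e :: "'x + 'z \<Rightarrow> 'm" and \<chi>
  proof -
    have "case_sum e id \<circ> map_sum Inl id = case_sum (e \<circ> Inl) id"
      by (auto simp: fun_eq_iff map_sum_def split: sum.split)
    then show ?thesis by (simp add: sat_map)
  qed
  define \<Sigma> where "\<Sigma> = ?\<eta> ` p \<union> \<delta> ` I"
  have "consistent C \<Sigma>"
    unfolding consistent_def
  proof (intro allI impI)
    fix \<Delta> assume \<Delta>: "finite \<Delta>" "\<Delta> \<subseteq> \<Sigma>"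
    obtain p\<^sub>0 where p\<^sub>0: "finite p\<^sub>0" "p\<^sub>0 \<subseteq> p" "\<Delta> \<inter> ?\<eta> ` p = ?\<eta> ` p\<^sub>0"
      using finite_subset_image[of "\<Delta> \<inter> ?\<eta> ` p" ?\<eta> p] \<Delta>(1) by auto
    obtain J where J: "finite J" "J \<subseteq> I" "\<Delta> \<inter> \<delta> ` I = \<delta> ` J"
      using finite_subset_image[of "\<Delta> \<inter> \<delta> ` I" \<delta> I] \<Delta>(1) by auto
    from p\<^sub>0(2) p_sub have "p\<^sub>0 \<subseteq> formulas L (X <+> A)" by blast
    from finite_conjunction[OF p\<^sub>0(1) this] obtain \<theta> where \<theta>: "\<theta> \<in> formulas L (X <+> A)"
      "\<And>e. holds C e \<theta> \<longleftrightarrow> (\<forall>\<chi>\<in>p\<^sub>0. holds C e \<chi>)" by blast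
    have "\<theta> \<in> p" using \<theta> p\<^sub>0(2) by (auto simp: p tp_def)
    from finite_distinct_list[OF J(1)] obtain js where js: "set js = J" "distinct js" by blast
    define js' where "js' = sort_key fst js"
    have "\<exists>w x. (\<forall>i y. i \<notin> set js' \<longrightarrow> w (i, y) = undefined) \<and> sol \<theta> x \<and>
        (\<forall>i\<in>set js'. rel_of \<phi> x (\<lambda>y. w (i, y)) \<longleftrightarrow> \<not> G i w)"
    proof (rule diagonal_path[where I = I])
      show "G i w \<longleftrightarrow> G i w'"
        if i: "i \<in> I" and "\<And>y. w (i, y) = w' (i, y)" "\<And>j y. fst j < fst i \<Longrightarrow> w (j, y) = w' (j, y)"
        for i w w'
        unfolding G_def
      proof (rule sat_cong)
        fix v assume "v \<in> fv (g (fst i) (snd i))"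
        then have "v \<in> Y <+> (({..<fst i} \<times> K) \<times> Y) <+> A"
          using gF[OF i] by (auto simp: F_def formulas_def)
        then show "case_sum (\<lambda>y. w (i, y)) (case_sum w id) v = case_sum (\<lambda>y. w' (i, y)) (case_sum w' id) v"
          using that(2,3) by auto
      qed
      show "set js' \<subseteq> I" "distinct js'" using js J(2) by (simp_all add: js'_def)
      show "sorted_wrt (\<lambda>i j. fst i \<le> fst j) js'"
        using sorted_sort_key[of fst js] by (simp only: sorted_map js'_def)
      show "has_tree (rel_of \<phi>) (length js') (sol \<theta>)" using trees[OF \<open>\<theta> \<in> p\<close>] .
    qed
    then obtain w x where w: "sol \<theta> x" "\<forall>i\<in>J. rel_of \<phi> x (\<lambda>y. w (i, y)) \<longleftrightarrow> \<not> G i w"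
      using js by (auto simp: js'_def)
    have "holds C (case_sum (case_sum x w) id) \<xi>" if "\<xi> \<in> \<Delta>" for \<xi>
    proof -
      have "\<xi> \<in> (\<Delta> \<inter> ?\<eta> ` p) \<union> (\<Delta> \<inter> \<delta> ` I)" using that \<Delta>(2) unfolding \<Sigma>_def by blast
      then have "\<xi> \<in> ?\<eta> ` p\<^sub>0 \<union> \<delta> ` J" unfolding p\<^sub>0(3) J(3) .
      then consider \<chi> where "\<chi> \<in> p\<^sub>0" "\<xi> = ?\<eta> \<chi>" | i where "i \<in> J" "\<xi> = \<delta> i"
        by blast
      then show ?thesis
      proof cases
        case 1
        then show ?thesis using w(1) \<theta>(2) by (simp add: \<eta> case_sum_o_inj)
      next
        case 2
        then show ?thesis using w(2) J(2) \<delta>_iff[of i "case_sum x w"] by (auto simp: case_sum_o_inj)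
      qed
    qed
    then show "\<exists>e. realizes C e \<Delta>" unfolding realizes_def by blast
  qed
  moreover have "\<Sigma> \<subseteq> formulas L (V <+> A)"
  proof -
    have "?\<eta> \<chi> \<in> formulas L (V <+> A)" if "\<chi> \<in> p" for \<chi>
      using that p_sub by (intro map_formulasI[of \<chi> L "X <+> A"]) (auto simp: V_def)
    then show ?thesis using \<delta>(1) by (auto simp: \<Sigma>_def)
  qed
  ultimately obtain e where e: "realizes C e \<Sigma>"
    using small_tuple_saturation[OF \<open>small V\<close> \<open>small A\<close>] by blast
  define b where "b = e \<circ> Inl"
  define w where "w = e \<circ> Inr"
  define B where "B = A \<union> w ` (I \<times> Y)"
  define q where "q = tp L C X b B"
  have "q \<in> complete_types L C X B"
  proof -
    have "realizes C b \<Delta>" if "\<Delta> \<subseteq> q" for \<Delta>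
      using that by (auto simp: realizes_def q_def tp_def)
    then have "consistent C q" unfolding consistent_def by blast
    then show ?thesis by (auto simp: complete_types_def q_def tp_def)
  qed
  moreover have "p \<subseteq> q"
  proof
    fix \<chi> assume "\<chi> \<in> p"
    then have "holds C (case_sum e id) (?\<eta> \<chi>)" using e by (auto simp: realizes_def \<Sigma>_def)
    moreover have "\<chi> \<in> formulas L (X <+> B)"
      using \<open>\<chi> \<in> p\<close> p_sub formulas_mono[of \<chi> L "X <+> A" "X <+> B"] by (auto simp: B_def)
    ultimately show "\<chi> \<in> q" by (simp add: q_def tp_def \<eta> b_def)
  qed
  moreover have "A \<subseteq> B" by (simp add: B_def)
  moreover have "small B"
    unfolding B_def by (intro small_Un \<open>small A\<close> small_image \<open>small (I \<times> Y)\<close>)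
  ultimately have "definable_over L C X B q B" using stable unfolding stable_def by blast
  from this[unfolded definable_over_def, rule_format, OF Y \<phi>]
  obtain \<psi> where \<psi>: "\<psi> \<in> formulas L (Y <+> B)"
    "\<And>c. c ` Y \<subseteq> B \<Longrightarrow> inst_right c \<phi> \<in> q \<longleftrightarrow> holds C (case_sum c id) \<psi>" by blast

  define \<nu> where "\<nu> u = (if u \<in> A then Inr u else Inl (inv_into (I \<times> Y) w u))" for u
  have \<nu>: "\<nu> u \<in> (I \<times> Y) <+> A" "case_sum w id (\<nu> u) = u" if "u \<in> B" for u
  proof -
    have "u \<in> w ` (I \<times> Y)" if "u \<notin> A" using \<open>u \<in> B\<close> that by (simp add: B_def)
    then show "\<nu> u \<in> (I \<times> Y) <+> A" "case_sum w id (\<nu> u) = u"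
      using inv_into_into[of u w "I \<times> Y"] f_inv_into_f[of u w "I \<times> Y"]
      by (auto simp: \<nu>_def simp del: mem_Sigma_iff)
  qed
  let ?\<psi> = "map_fm (map_sum id \<nu>) \<psi>"
  have \<psi>': "?\<psi> \<in> formulas L (Y <+> (I \<times> Y) <+> A)"
    using map_sum_id_image[of B \<nu> "(I \<times> Y) <+> A" Y] \<nu>(1) by (intro map_formulasI[OF \<psi>(1)]) blast
  \<comment> \<open>Only finitely many names occur in \<open>\<psi>\<close>, so \<open>\<psi>\<close> is itself named, at any level above theirs.\<close>
  have "finite {n. \<exists>k y. Inr (Inl ((n, k), y)) \<in> fv ?\<psi>}"
  proof (rule finite_subset)
    show "{n. \<exists>k y. Inr (Inl ((n, k), y)) \<in> fv ?\<psi>} \<subseteq>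
        (\<lambda>v. case v of Inr (Inl ((n, k), y)) \<Rightarrow> n) ` fv ?\<psi>" by force
  qed (simp add: finite_fv)
  then obtain n where n: "\<And>m k y. Inr (Inl ((m, k), y)) \<in> fv ?\<psi> \<Longrightarrow> m < n"
    unfolding finite_nat_set_iff_bounded by blast
  have "?\<psi> \<in> F n"
  proof -
    have "fv ?\<psi> \<subseteq> Y <+> (({..<n} \<times> K) \<times> Y) <+> A"
    proof
      fix v assume v: "v \<in> fv ?\<psi>"
      then have "v \<in> Y <+> (I \<times> Y) <+> A" using \<psi>' by (auto simp: formulas_def)
      then show "v \<in> Y <+> (({..<n} \<times> K) \<times> Y) <+> A" using v n by (auto simp: I_def)
    qed
    then show ?thesis using \<psi>' by (simp add: F_def formulas_def)
  qed
  then obtain k where k: "k \<in> K" "g n k = ?\<psi>" using g[of n] by (metis imageE)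
  define c where "c y = w ((n, k), y)" for y
  have i: "(n, k) \<in> I" using k(1) by (simp add: I_def)
  then have c: "c ` Y \<subseteq> B" by (auto simp: c_def B_def)
  have "holds C (case_sum c (case_sum w id) \<circ> map_sum id \<nu>) \<psi> \<longleftrightarrow> holds C (case_sum c id) \<psi>"
  proof (rule sat_cong)
    fix v assume "v \<in> fv \<psi>"
    then have "v \<in> Y <+> B" using \<psi>(1) by (auto simp: formulas_def)
    then show "(case_sum c (case_sum w id) \<circ> map_sum id \<nu>) v = case_sum c id v"
      using \<nu>(2) by (elim PlusE) simp_all
  qed
  then have "G (n, k) w \<longleftrightarrow> holds C (case_sum c id) \<psi>"
    by (simp add: G_def k(2) sat_map flip: c_def)
  moreover have "rel_of \<phi> b c \<longleftrightarrow> \<not> G (n, k) w"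
  proof -
    have "holds C (case_sum e id) (\<delta> (n, k))" using e i by (auto simp: realizes_def \<Sigma>_def)
    then have "rel_of \<phi> (e \<circ> Inl) (\<lambda>y. e (Inr ((n, k), y))) \<longleftrightarrow> \<not> G (n, k) (e \<circ> Inr)"
      using \<delta>_iff[OF i] by blast
    moreover have "(\<lambda>y. e (Inr ((n, k), y))) = c" by (simp add: c_def w_def fun_eq_iff)
    ultimately show ?thesis by (simp add: b_def w_def)
  qed
  moreover have "inst_right c \<phi> \<in> q \<longleftrightarrow> rel_of \<phi> b c"
  proof -
    have "inst_right c \<phi> \<in> formulas L (X <+> B)"
      unfolding inst_right_def using c by (intro map_formulasI[OF \<phi>]) auto
    then show ?thesis by (simp add: q_def tp_def sol_inst_right)
  qed
  ultimately show False using \<psi>(2)[OF c] by blast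
qed

lemma stable_definable_extension:
  fixes a :: "'x \<Rightarrow> 'm"
  assumes "small X" "small A" and p: "p = tp L C X a A" and "stable L C \<mu> X A p"
    and M: "elementary_submodel L C M" "M \<subseteq> A" "definable_over L C X A p M"
  shows "stable L C \<mu> X M (restrict_type L X p M)"
  unfolding stable_def definable_over_def
proof (intro allI impI)
  fix B q \<phi> and Y :: "nat set"
  assume q: "q \<in> complete_types L C X B" "restrict_type L X p M \<subseteq> q"
    and Y: "finite Y" and \<phi>: "\<phi> \<in> formulas L (X <+> Y)"
  have p_sub: "p \<subseteq> formulas L (X <+> A)" by (auto simp: p tp_def)
  from stable_imp_bounded_trees[OF assms(1-4) Y \<phi>] obtain n \<chi>
    where "\<chi> \<in> p" "\<not> has_tree (rel_of \<phi>) n (sol \<chi>)" by blast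
  from bounded_trees_restrict[OF p_sub M(2,3,1) \<phi> this] obtain \<theta>
    where "\<theta> \<in> restrict_type L X p M" "\<not> has_tree (rel_of \<phi>) n (sol \<theta>)" by blast
  with q(2) show "\<exists>\<psi>\<in>formulas L (Y <+> B). \<forall>b. b ` Y \<subseteq> B \<longrightarrow>
      (inst_right b \<phi> \<in> q \<longleftrightarrow> holds C (case_sum b id) \<psi>)"
    by (intro definable_if_bounded_trees[OF q(1) \<phi>]) blast+
qed

end


section \<open>Restricting a definable type\<close>

theorem corollary3p5:
  fixes L :: "('f, 'r) lang"
    and T :: "('f, 'r) sentence set"
    and \<mu> :: "'k rel"
    and C :: "('f, 'r, 'm) struct"
    and X :: "'x set"
    and a :: "'x \<Rightarrow> 'm"
    and A M :: "'m set"
    and p :: "('f, 'r, 'x + 'm) fm set"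
  assumes "complete_theory L T"
    and "monster_model L T \<mu> C"
    and "|X| <o \<mu>"
    and "|A| <o \<mu>"
    and "p = tp L C X a A"
    and "elementary_submodel L C M"
    and "M \<subseteq> A"
    and "definable_over L C X A p M"
  shows "(NIP L C X p \<longrightarrow>
            NIP L C X (restrict_type L X p M) \<and>
            dpr_eq L C \<mu> X M (restrict_type L X p M) A p)
       \<and> (stable L C \<mu> X A p \<longrightarrow>
            stable L C \<mu> X M (restrict_type L X p M) \<and>
            dpr_eq L C \<mu> X M (restrict_type L X p M) A p)"
proof -
  interpret monster L T \<mu> C using assms(2) by unfold_locales
  have p: "p \<subseteq> formulas L (X <+> A)" using assms(5) by (auto simp: tp_def)
  have "dpr_eq L C \<mu> X M (restrict_type L X p M) A p"
    unfolding dpr_eq_def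
    using dpr_less_extension[OF assms(7)] dpr_less_restrict[OF p assms(7,8,3,4,6)] by blast
  moreover have "NIP L C X p \<longrightarrow> NIP L C X (restrict_type L X p M)"
    using IP_definable_extension[OF p assms(7,8,3,4,6)] by blast
  moreover have "stable L C \<mu> X A p \<longrightarrow> stable L C \<mu> X M (restrict_type L X p M)"
    using stable_definable_extension[OF assms(3-5) _ assms(6-8)] by blast
  ultimately show ?thesis by blast
qed

end
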